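(* Let $P\subset\mathbb{R}^3$ be the (Archimedean) truncated dodecahedron, i.e. the convex polyhedron with $20$ regular triangular and $12$ regular decagonal faces, all edges of equal length, with one triangle and two decagons meeting at each vertex, centered at the origin. Then $P$ is not second-order rigid.
   Context: Let $P$ have vertex set $V$, edge set $E$ and facet set $F$, and write $i\sim\sigma$ if vertex $i$ lies on facet $\sigma$. $P$ is identified with the pair $(\boldsymbol p,\boldsymbol a)$ of maps $\boldsymbol p:V\to\mathbb{R}^3$ (vertices) and $\boldsymbol a:F\to\mathbb{R}^3$ (outward facet normals), scaled such that $\langle p_i,a_\sigma\rangle=1$ for $i\sim\sigma$ and $\langle p_i,a_\sigma\rangle<1$ for $i\not\sim\sigma$. A first-order motion of $P$ is a pair $(\dot{\boldsymbol p},\dot{\boldsymbol a})$ of maps $\dot{\boldsymbol p}:V\to\mathbb{R}^3$, $\dot{\boldsymbol a}:F\to\mathbb{R}^3$ with $\langle p_i-p_j,\dot p_i-\dot p_j\rangle=0$ for all $ij\in E$ and $\langle p_i,\dot a_\sigma\rangle+\langle\dot p_i,a_\sigma\rangle=0$ for all $i\sim\sigma$. It is trivial if $\langle p_i-p_j,\dot p_i-\dot p_j\rangle=0$ for all $i,j\in V$. A second-order motion of $P$ is a tuple $(\dot{\boldsymbol p},\dot{\boldsymbol a};\ddot{\boldsymbol p},\ddot{\boldsymbol a})$ of maps $\dot{\boldsymbol p},\ddot{\boldsymbol p}:V\to\mathbb{R}^3$, $\dot{\boldsymbol a},\ddot{\boldsymbol a}:F\to\mathbb{R}^3$ such that $(\dot{\boldsymbol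 p},\dot{\boldsymbol a})$ is a first-order motion, $\langle p_i-p_j,\ddot p_i-\ddot p_j\rangle+\langle\dot p_i-\dot p_j,\dot p_i-\dot p_j\rangle=0$ for all $ij\in E$, and $\langle p_i,\ddot a_\sigma\rangle+2\langle\dot p_i,\dot a_\sigma\rangle+\langle\ddot p_i,a_\sigma\rangle=0$ for all $i\sim\sigma$. It is trivial if $(\dot{\boldsymbol p},\dot{\boldsymbol a})$ is trivial as a first-order motion. $P$ is second-order rigid if all its second-order motions are trivial. *)

theory Defs
  imports "HOL-Analysis.Analysis"
begin

definition vertex_set :: "(real^3) set \<Rightarrow> (real^3) set" where
  "vertex_set P = {v. v extreme_point_of P}"

definition facet_set :: "(real^3) set \<Rightarrow> (real^3) set set" where
  "facet_set P = {\<sigma>. \<sigma> facet_of P}"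

definition adjacent :: "(real^3) set \<Rightarrow> real^3 \<Rightarrow> real^3 \<Rightarrow> bool" where
  "adjacent P x y \<longleftrightarrow> x \<in> vertex_set P \<and> y \<in> vertex_set P \<and> closed_segment x y edge_of P"

text \<open>The vertices and facets of a polytope serve as their own index sets: the position
  map is the identity on \<open>vertex_set P\<close>, and incidence of a vertex with a facet is membership.
  A motion assigns vectors to vertices and to facets; its values elsewhere are irrelevant.\<close>

definition facet_normals :: "(real^3) set \<Rightarrow> ((real^3) set \<Rightarrow> real^3) \<Rightarrow> bool" where
  "facet_normals P a \<longleftrightarrow>
     (\<forall>x\<in>vertex_set P. \<forall>\<sigma>\<in>facet_set P.
        (x \<in> \<sigma> \<longrightarrow> x \<bullet> a \<sigma> = 1) \<and> (x \<notin> \<sigma> \<longrightarrow> x \<bullet> a \<sigma> < 1))"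

definition first_order_motion ::
  "(real^3) set \<Rightarrow> ((real^3) set \<Rightarrow> real^3) \<Rightarrow>
   (real^3 \<Rightarrow> real^3) \<Rightarrow> ((real^3) set \<Rightarrow> real^3) \<Rightarrow> bool" where
  "first_order_motion P a p' a' \<longleftrightarrow>
     (\<forall>x y. adjacent P x y \<longrightarrow> (x - y) \<bullet> (p' x - p' y) = 0) \<and>
     (\<forall>x\<in>vertex_set P. \<forall>\<sigma>\<in>facet_set P. x \<in> \<sigma> \<longrightarrow> x \<bullet> a' \<sigma> + p' x \<bullet> a \<sigma> = 0)"

definition trivial_first_order_motion :: "(real^3) set \<Rightarrow> (real^3 \<Rightarrow> real^3) \<Rightarrow> bool" where
  "trivial_first_order_motion P p' \<longleftrightarrow>
     (\<forall>x\<in>vertex_set P. \<forall>y\<in>vertex_set P. (x - y) \<bullet> (p' x - p' y) = 0)"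

definition second_order_motion ::
  "(real^3) set \<Rightarrow> ((real^3) set \<Rightarrow> real^3) \<Rightarrow>
   (real^3 \<Rightarrow> real^3) \<Rightarrow> ((real^3) set \<Rightarrow> real^3) \<Rightarrow>
   (real^3 \<Rightarrow> real^3) \<Rightarrow> ((real^3) set \<Rightarrow> real^3) \<Rightarrow> bool" where
  "second_order_motion P a p' a' p'' a'' \<longleftrightarrow>
     first_order_motion P a p' a' \<and>
     (\<forall>x y. adjacent P x y \<longrightarrow>
        (x - y) \<bullet> (p'' x - p'' y) + (p' x - p' y) \<bullet> (p' x - p' y) = 0) \<and>
     (\<forall>x\<in>vertex_set P. \<forall>\<sigma>\<in>facet_set P. x \<in> \<sigma> \<longrightarrow>
        x \<bullet> a'' \<sigma> + 2 * (p' x \<bullet> a' \<sigma>) + p'' x \<bullet> a \<sigma> = 0)"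

definition second_order_rigid :: "(real^3) set \<Rightarrow> ((real^3) set \<Rightarrow> real^3) \<Rightarrow> bool" where
  "second_order_rigid P a \<longleftrightarrow>
     (\<forall>p' a' p'' a''. second_order_motion P a p' a' p'' a'' \<longrightarrow> trivial_first_order_motion P p')"

definition regular_polygon :: "nat \<Rightarrow> (real^3) set \<Rightarrow> bool" where
  "regular_polygon n \<sigma> \<longleftrightarrow> 3 \<le> n \<and>
     (\<exists>c u w r. norm u = 1 \<and> norm w = 1 \<and> u \<bullet> w = 0 \<and> 0 < r \<and>
        \<sigma> = convex hull ((\<lambda>k. c + r *\<^sub>R (cos (2 * pi * real k / real n) *\<^sub>R u +
                                       sin (2 * pi * real k / real n) *\<^sub>R w)) ` {..<n}))"

text \<open>The conditions below determine the polytope up to scaling and orthogonal maps.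
  ``Centered at the origin'' means that the centroid of the vertices is the origin.\<close>

definition truncated_dodecahedron :: "(real^3) set \<Rightarrow> bool" where
  "truncated_dodecahedron P \<longleftrightarrow>
     polytope P \<and> aff_dim P = 3 \<and>
     (\<forall>\<sigma>\<in>facet_set P. regular_polygon 3 \<sigma> \<or> regular_polygon 10 \<sigma>) \<and>
     card {\<sigma> \<in> facet_set P. regular_polygon 3 \<sigma>} = 20 \<and>
     card {\<sigma> \<in> facet_set P. regular_polygon 10 \<sigma>} = 12 \<and>
     (\<exists>l. \<forall>x y. adjacent P x y \<longrightarrow> dist x y = l) \<and>
     (\<forall>x\<in>vertex_set P.
        card {\<sigma> \<in> facet_set P. x \<in> \<sigma> \<and> regular_polygon 3 \<sigma>} = 1 \<and>
        card {\<sigma> \<in> facet_set P. x \<in> \<sigma> \<and> regular_polygon 10 \<sigma>} = 2) \<and>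
     (\<Sum>x\<in>vertex_set P. x) = 0"

end

theory Submission
  imports Defs "HOL-Computational_Algebra.Primes"
begin

text \<open>At every vertex one triangle and two decagons meet, and four consecutive vertices of a decagon
  satisfy a linear recurrence with coefficients in \<open>\<int>[golden]\<close>. Hence the four points formed by
  a vertex and its neighbours determine the whole polytope by affine extrapolation along edges. In a
  suitable orthogonal frame all vertices have coordinates in \<open>\<int>[golden]\<close>; the sixty points of the
  model exhaust them because there are only twenty triangles, and the centroid condition
  puts the origin of the frame in the right place.

  Modulo trivial motions, the first-order motions form the odd four-dimensional irreducible
  representation of the full icosahedral group, and so do the obstructions to a second-order
  extension. A quadratic map between two odd representations vanishes, so every first-order motion extends.
  The motion used here is the one invariant under the rotations of an inscribed tetrahedron, whose
  coordinates are again in \<open>\<int>[golden]\<close>.\<close>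

subsection \<open>Regular polygons\<close>

text \<open>The golden ratio, written as a cosine because \<open>2 * cos (2 * pi / 10)\<close> is
  the coefficient of the decagon in \<open>polygon_cycle\<close>.\<close>

definition golden :: real where
  "golden = 2 * cos (pi / 5)"

lemma golden_pos: "golden > 0"
  unfolding golden_def by (simp add: cos_gt_zero)

text \<open>The angles \<open>2 * pi / 5\<close> and \<open>3 * pi / 5\<close> are supplementary, so
  the double and triple angle formulas give a cubic equation for \<open>cos (pi / 5)\<close>. Its
  factor \<open>c + 1\<close> is positive and can be cancelled.\<close>

lemma golden_sq: "golden * golden = golden + 1"
proof -
  define c where "c = cos (pi / 5)"
  have c: "c > 0" unfolding c_def by (simp add: cos_gt_zero)
  have "cos (2 * (pi / 5)) = - cos (3 * (pi / 5))"
    using cos_minus_pi[of "3 * (pi / 5)"] cos_minus[of "2 * (pi / 5)"]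
    by (simp add: field_simps)
  then have "2 * c\<^sup>2 - 1 = - (4 * c ^ 3 - 3 * c)"
    by (simp only: cos_double_cos cos_treble_cos c_def)
  then have "(c + 1) * (4 * c\<^sup>2 - 2 * c - 1) = 0"
    by (simp add: algebra_simps power2_eq_square power3_eq_cube)
  with c have "4 * c\<^sup>2 - 2 * c - 1 = 0" by auto
  then show ?thesis
    unfolding golden_def c_def[symmetric] by (simp add: algebra_simps power2_eq_square)
qed

text \<open>Integer indices run around the polygon periodically, so neighbours need no wrap-around.
  The recurrence says that a plane rotation plus its inverse is twice the cosine of its angle; it is
  stated for edge vectors so that the centre of the polygon drops out.\<close>

definition polygon_cycle :: "nat \<Rightarrow> (real^3) set \<Rightarrow> (int \<Rightarrow> real^3) \<Rightarrow> bool" where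
  "polygon_cycle n \<sigma> f \<longleftrightarrow>
     {v. v extreme_point_of \<sigma>} = range f \<and> card (range f) = n \<and>
     (\<forall>k. closed_segment (f k) (f (k + 1)) edge_of \<sigma>) \<and>
     (\<forall>k. f (k + 1) \<noteq> f (k - 1)) \<and>
     (\<forall>k. f (k + 2) - f (k + 1) =
        (2 * cos (2 * pi / real n)) *\<^sub>R (f (k + 1) - f k) - (f k - f (k - 1)))"

text \<open>Here \<open>(2 * i - 1) * pi / n\<close> is the angle from the outward normal of the
  edge between vertices 0 and 1 to vertex \<open>i\<close>. The difference of the cosines is twice a
  product of two sines, whose angles lie strictly between 0 and pi once \<open>i\<close> is at least
  2.\<close>

lemma cos_le_cos_edge:
  fixes i :: int and n :: nat
  assumes "3 \<le> n" "0 \<le> i" "i < int n"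
  shows "cos ((2 * of_int i - 1) * pi / real n) \<le> cos (pi / real n)"
    and "cos ((2 * of_int i - 1) * pi / real n) = cos (pi / real n) \<Longrightarrow> i = 0 \<or> i = 1"
proof -
  have n: "real n > 0" using assms by simp
  have diff: "cos (pi / real n) - cos ((2 * of_int i - 1) * pi / real n)
      = 2 * sin (of_int i * pi / real n) * sin ((of_int i - 1) * pi / real n)"
  proof -
    have "(pi / real n + (2 * of_int i - 1) * pi / real n) / 2 = of_int i * pi / real n"
      "((2 * of_int i - 1) * pi / real n - pi / real n) / 2 = (of_int i - 1) * pi / real n"
      using n by (simp_all add: field_simps)
    then show ?thesis unfolding cos_diff_cos by simp
  qed
  have *: "0 < sin (of_int i * pi / real n) * sin ((of_int i - 1) * pi / real n)" if "2 \<le> i"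
  proof -
    have i: "real_of_int i < real n" "real_of_int i \<ge> 2"
      using assms(3) that by linarith+
    have "of_int i * pi < real n * pi" "(of_int i - 1) * pi < real n * pi"
      using i by (simp_all add: mult_strict_right_mono)
    then have "0 < sin (of_int i * pi / real n)" "0 < sin ((of_int i - 1) * pi / real n)"
      using i n by (auto intro!: sin_gt_zero simp: field_simps)
    then show ?thesis by simp
  qed
  have cases: "i = 0 \<or> i = 1 \<or> 2 \<le> i" using assms by linarith
  show "cos ((2 * of_int i - 1) * pi / real n) \<le> cos (pi / real n)"
    using cases diff * by force
  show "cos ((2 * of_int i - 1) * pi / real n) = cos (pi / real n) \<Longrightarrow> i = 0 \<or> i = 1"
    using cases diff * by force
qed

text \<open>Linear functionals normal to the edges attain their maximum over the listed points only
  at the two ends of an edge. This exposes the edges as faces and also shows that the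
  \<open>n\<close> listed points are distinct extreme points.\<close>

lemma regular_polygon_cycle:
  assumes "regular_polygon n \<sigma>"
  obtains f where "polygon_cycle n \<sigma> f"
proof -
  obtain c u w r where n3: "3 \<le> n" and u: "norm u = 1" and w: "norm w = 1" and uw: "u \<bullet> w = 0"
    and r: "0 < r"
    and \<sigma>: "\<sigma> = convex hull ((\<lambda>k. c + r *\<^sub>R (cos (2 * pi * real k / real n) *\<^sub>R u +
                                       sin (2 * pi * real k / real n) *\<^sub>R w)) ` {..<n})"
    using assms unfolding regular_polygon_def by blast
  have n: "real n > 0" using n3 by simp
  define f :: "int \<Rightarrow> real^3" where
    "f k = c + r *\<^sub>R (cos (2 * pi * of_int k / real n) *\<^sub>R u + sin (2 * pi * of_int k / real n) *\<^sub>R w)" for k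
  \<comment> \<open>The unit vector from the centre towards the midpoint of \<open>f k\<close> and
    \<open>f (k + 1)\<close>, an outward normal of that edge.\<close>
  define d :: "int \<Rightarrow> real^3" where
    "d k = cos ((2 * of_int k + 1) * pi / real n) *\<^sub>R u + sin ((2 * of_int k + 1) * pi / real n) *\<^sub>R w" for k
  have uu: "u \<bullet> u = 1" "w \<bullet> w = 1" "w \<bullet> u = 0"
    using u w uw by (simp_all add: norm_eq_1 inner_commute)
  have period1: "f (k + int n) = f k" for k
  proof -
    have "2 * pi * of_int (k + int n) / real n = 2 * pi * of_int k / real n + 2 * pi"
      using n by (simp add: field_simps)
    then show ?thesis unfolding f_def by (simp del: of_int_add)
  qed
  have period_nat: "f (k + int m * int n) = f k" for k m
  proof (induction m)
    case (Suc m)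
    have "k + int (Suc m) * int n = (k + int m * int n) + int n" by (simp add: algebra_simps)
    with Suc show ?case using period1 by metis
  qed simp
  have period: "f (k + m * int n) = f k" for k m
  proof (cases "m \<ge> 0")
    case True then show ?thesis using period_nat[of k "nat m"] by simp
  next
    case False then show ?thesis using period_nat[of "k + m * int n" "nat (- m)"] by simp
  qed
  have fmod: "f (k + (j - k) mod int n) = f j" for j k
  proof -
    have "k + (j - k) mod int n = j + (- ((j - k) div int n)) * int n"
      using div_mult_mod_eq[of "j - k" "int n"] by (simp add: algebra_simps)
    then show ?thesis by (simp only: period)
  qed
  have inn: "d k \<bullet> (f (k + i) - c) = r * cos ((2 * of_int i - 1) * pi / real n)" for k i
  proof -
    have "2 * pi * of_int (k + i) / real n = (2 * of_int k + 1) * pi / real n + (2 * of_int i - 1) * pi / real n"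
      by (simp add: add_divide_distrib[symmetric] algebra_simps)
    then have e: "2 * pi * of_int (k + i) / real n - (2 * of_int k + 1) * pi / real n = (2 * of_int i - 1) * pi / real n"
      by simp
    have "d k \<bullet> (f (k + i) - c) = r * cos (2 * pi * of_int (k + i) / real n - (2 * of_int k + 1) * pi / real n)"
      unfolding d_def f_def cos_diff
      by (simp only: add_diff_cancel_left' inner_scaleR_left inner_scaleR_right inner_add_left
          inner_add_right uu uw) (simp add: algebra_simps)
    then show ?thesis unfolding e .
  qed
  define b where "b k = d k \<bullet> c + r * cos (pi / real n)" for k
  have le: "d k \<bullet> f j \<le> b k" and eq: "d k \<bullet> f j = b k \<Longrightarrow> f j = f k \<or> f j = f (k + 1)"
    and eqi: "d k \<bullet> f j = b k \<Longrightarrow> (j - k) mod int n \<in> {0, 1}" for j k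
  proof -
    define i where "i = (j - k) mod int n"
    have i: "0 \<le> i" "i < int n" using n3 by (simp_all add: i_def)
    have ji: "f j = f (k + i)" using fmod by (simp add: i_def)
    have v: "d k \<bullet> f j = d k \<bullet> c + r * cos ((2 * of_int i - 1) * pi / real n)"
      using inn[of k i] unfolding ji by (simp add: inner_diff_right)
    show "d k \<bullet> f j \<le> b k"
      using cos_le_cos_edge(1)[OF n3 i] r unfolding v b_def by simp
    assume "d k \<bullet> f j = b k"
    then have "i = 0 \<or> i = 1"
      using cos_le_cos_edge(2)[OF n3 i] r unfolding v b_def by simp
    then show "f j = f k \<or> f j = f (k + 1)" "(j - k) mod int n \<in> {0, 1}"
      using ji by (auto simp: i_def)
  qed
  have at: "d k \<bullet> f k = b k" "d k \<bullet> f (k + 1) = b k" for k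
    using inn[of k 0] inn[of k 1] cos_minus[of "pi / real n"] by (simp_all add: b_def inner_diff_right)
  \<comment> \<open>Equal points lie on the supporting lines of edge \<open>k\<close> and of edge
    \<open>k - 1\<close>. Hence both \<open>i\<close> and \<open>i + 1\<close> are 0 or 1 modulo
    \<open>n\<close>, and \<open>n\<close> being at least 3 excludes \<open>i = 1\<close>.\<close>
  have inj: "(j - k) mod int n = 0" if "f j = f k" for j k
  proof -
    define i where "i = (j - k) mod int n"
    have i: "0 \<le> i" "i < int n" using n3 by (simp_all add: i_def)
    have 1: "i \<in> {0, 1}" using eqi[of k j] at(1)[of k] that by (simp add: i_def)
    have "(j - (k - 1)) mod int n \<in> {0, 1}"
      using eqi[of "k - 1" j] at(2)[of "k - 1"] that by simp
    moreover have "(j - (k - 1)) mod int n = (i + 1) mod int n"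
      by (simp add: i_def mod_simps algebra_simps)
    moreover have "i = 1 \<Longrightarrow> (i + 1) mod int n = 2" using n3 by simp
    ultimately show ?thesis using 1 by (auto simp: i_def)
  qed
  have rng: "range f = (\<lambda>k. f (int k)) ` {..<n}"
  proof
    show "range f \<subseteq> (\<lambda>k. f (int k)) ` {..<n}"
    proof
      fix x assume "x \<in> range f"
      then obtain j where "x = f j" by blast
      then have "x = f (int (nat (j mod int n)))" using fmod[of 0 j] n3 by simp
      moreover have "nat (j mod int n) < n" using n3 by (simp add: nat_less_iff)
      ultimately show "x \<in> (\<lambda>k. f (int k)) ` {..<n}" by blast
    qed
  qed auto
  have card: "card (range f) = n"
  proof -
    have "inj_on (\<lambda>k. f (int k)) {..<n}"
    proof (rule inj_onI)
      fix x y assume xy: "x \<in> {..<n}" "y \<in> {..<n}" "f (int x) = f (int y)"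
      have "int n dvd int x - int y" using inj[OF xy(3)] by (simp add: mod_eq_0_iff_dvd)
      then show "x = y" using xy(1,2)
        by (metis int_int_eq lessThan_iff mod_eq_dvd_iff mod_pos_pos_trivial of_nat_0_le_iff of_nat_less_iff)
    qed
    then show ?thesis unfolding rng by (simp add: card_image)
  qed
  have fin: "finite (range f)" unfolding rng by simp
  have hull: "\<sigma> = convex hull (range f)"
    unfolding \<sigma> rng by (simp add: f_def)
  have conv: "convex \<sigma>" unfolding hull by simp
  have seg: "closed_segment (f k) (f (k + 1)) face_of \<sigma>" for k
  proof -
    have "\<sigma> \<subseteq> {x. d k \<bullet> x \<le> b k}"
      unfolding hull using le by (intro hull_minimal) (auto simp: convex_halfspace_le)
    then have F: "(\<sigma> \<inter> {x. d k \<bullet> x = b k}) face_of \<sigma>"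
      using conv by (intro face_of_Int_supporting_hyperplane_le) auto
    \<comment> \<open>A face of the hull of finitely many points is the hull of some of them, and
      only two of the points attain the bound \<open>b k\<close>.\<close>
    then obtain S where S: "S \<subseteq> range f" "\<sigma> \<inter> {x. d k \<bullet> x = b k} = convex hull S"
      using face_of_convex_hull_subset[of "range f"] fin finite_imp_compact unfolding hull by blast
    have "S \<subseteq> {f k, f (k + 1)}"
    proof
      fix x assume x: "x \<in> S"
      then have "x \<in> \<sigma> \<inter> {x. d k \<bullet> x = b k}" unfolding S(2) by (rule hull_inc)
      then show "x \<in> {f k, f (k + 1)}" using eq S(1) x by blast
    qed
    then have "\<sigma> \<inter> {x. d k \<bullet> x = b k} \<subseteq> closed_segment (f k) (f (k + 1))"
      unfolding S(2) segment_convex_hull by (rule hull_mono)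
    moreover have "closed_segment (f k) (f (k + 1)) \<subseteq> \<sigma> \<inter> {x. d k \<bullet> x = b k}"
      using at[of k] F
      by (intro closed_segment_subset) (auto simp: hull hull_inc face_of_imp_convex)
    ultimately show ?thesis using F by (metis subset_antisym)
  qed
  have ne1: "f k \<noteq> f (k + 1)" for k
    using inj[of "k + 1" k] n3 by (auto simp: mod_pos_pos_trivial)
  have edge: "closed_segment (f k) (f (k + 1)) edge_of \<sigma>" for k
    using seg ne1 unfolding edge_of_def segment_convex_hull by (simp add: aff_dim_convex_hull)
  have ext: "{v. v extreme_point_of \<sigma>} = range f"
  proof
    show "{v. v extreme_point_of \<sigma>} \<subseteq> range f"
      unfolding hull using extreme_point_of_convex_hull by blast
    show "range f \<subseteq> {v. v extreme_point_of \<sigma>}"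
      using extreme_point_of_face[OF seg] extreme_point_of_segment by blast
  qed
  have ne2: "f (k + 1) \<noteq> f (k - 1)" for k
    using inj[of "k + 1" "k - 1"] n3 by (auto simp: mod_pos_pos_trivial)
  have rec1: "f (k + 1) + f (k - 1) = 2 *\<^sub>R c + (2 * cos (2 * pi / real n)) *\<^sub>R (f k - c)" for k
  proof -
    have a: "2 * pi * of_int (k + 1) / real n = 2 * pi * of_int k / real n + 2 * pi / real n"
      "2 * pi * of_int (k - 1) / real n = 2 * pi * of_int k / real n - 2 * pi / real n"
      by (simp_all add: add_divide_distrib[symmetric] diff_divide_distrib[symmetric] algebra_simps)
    show ?thesis
      unfolding f_def a cos_add cos_diff sin_add sin_diff
      by (simp add: vec_eq_iff algebra_simps)
  qed
  have rec: "f (k + 2) - f (k + 1) =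
        (2 * cos (2 * pi / real n)) *\<^sub>R (f (k + 1) - f k) - (f k - f (k - 1))" for k
  proof -
    \<comment> \<open>Subtracting two consecutive instances of \<open>rec1\<close> eliminates the
      centre \<open>c\<close>.\<close>
    have "f (k + 2) + f k = 2 *\<^sub>R c + (2 * cos (2 * pi / real n)) *\<^sub>R (f (k + 1) - c)"
      using rec1[of "k + 1"] by (simp add: add.commute)
    then have "f (k + 2) + f k - (f (k + 1) + f (k - 1)) = (2 * cos (2 * pi / real n)) *\<^sub>R (f (k + 1) - f k)"
      unfolding rec1 by (simp add: algebra_simps)
    then show ?thesis by (simp add: algebra_simps)
  qed
  show ?thesis
    by (rule that[of f]) (use ext card edge ne2 rec in \<open>auto simp: polygon_cycle_def\<close>)
qed

subsection \<open>The neighbourhood of a vertex\<close>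

text \<open>The edges to \<open>y1\<close> and \<open>y2\<close> border the triangle, the edge to
  \<open>y3\<close> separates the two decagons, and \<open>D1\<close> is the decagon on the side of
  \<open>y1\<close>. The labelling is fixed by the vertex up to \<open>corner_swap\<close>.\<close>

definition corner :: "(real^3) set \<Rightarrow> real^3 \<Rightarrow> real^3 \<Rightarrow> real^3 \<Rightarrow> real^3 \<Rightarrow>
    (real^3) set \<Rightarrow> (real^3) set \<Rightarrow> (real^3) set \<Rightarrow> bool" where
  "corner P x y1 y2 y3 T D1 D2 \<longleftrightarrow>
     x \<in> vertex_set P \<and> {\<sigma> \<in> facet_set P. x \<in> \<sigma>} = {T, D1, D2} \<and> distinct [T, D1, D2] \<and>
     regular_polygon 3 T \<and> regular_polygon 10 D1 \<and> regular_polygon 10 D2 \<and>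
     adjacent P x y1 \<and> adjacent P x y2 \<and> adjacent P x y3 \<and>
     T \<inter> D1 = closed_segment x y1 \<and> T \<inter> D2 = closed_segment x y2 \<and> D1 \<inter> D2 = closed_segment x y3"

lemma cornerD:
  assumes "corner P x y1 y2 y3 T D1 D2"
  shows "x \<in> vertex_set P" "T \<noteq> D1" "T \<noteq> D2" "D1 \<noteq> D2"
    "regular_polygon 3 T" "regular_polygon 10 D1" "regular_polygon 10 D2"
    "adjacent P x y1" "adjacent P x y2" "adjacent P x y3"
    "T \<inter> D1 = closed_segment x y1" "T \<inter> D2 = closed_segment x y2" "D1 \<inter> D2 = closed_segment x y3"
    "\<sigma> \<in> facet_set P \<Longrightarrow> x \<in> \<sigma> \<Longrightarrow> \<sigma> = T \<or> \<sigma> = D1 \<or> \<sigma> = D2"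
proof -
  show "x \<in> vertex_set P" "T \<noteq> D1" "T \<noteq> D2" "D1 \<noteq> D2"
    "regular_polygon 3 T" "regular_polygon 10 D1" "regular_polygon 10 D2"
    "adjacent P x y1" "adjacent P x y2" "adjacent P x y3"
    "T \<inter> D1 = closed_segment x y1" "T \<inter> D2 = closed_segment x y2" "D1 \<inter> D2 = closed_segment x y3"
    using assms unfolding corner_def by simp_all
  assume "\<sigma> \<in> facet_set P" "x \<in> \<sigma>"
  moreover have "{\<sigma> \<in> facet_set P. x \<in> \<sigma>} = {T, D1, D2}"
    using assms unfolding corner_def by simp
  ultimately have "\<sigma> \<in> {T, D1, D2}" by (metis (mono_tags, lifting) mem_Collect_eq)
  then show "\<sigma> = T \<or> \<sigma> = D1 \<or> \<sigma> = D2" by simp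
qed

lemma corner_swap: "corner P x y1 y2 y3 T D1 D2 \<Longrightarrow> corner P x y2 y1 y3 T D2 D1"
  unfolding corner_def by (simp add: insert_commute[of D1 D2] Int_commute[of D1 D2] eq_commute[of D1 D2])

lemma closed_segment_cancel: "closed_segment x a = closed_segment x b \<Longrightarrow> a = (b::real^3)"
  by (auto simp: doubleton_eq_iff)

lemma adjacent_sym: "adjacent P x y \<Longrightarrow> adjacent P y x"
  unfolding adjacent_def by (simp add: closed_segment_commute)

lemma adjacent_neq: "adjacent P x y \<Longrightarrow> x \<noteq> y"
  unfolding adjacent_def edge_of_def by auto

text \<open>The polytope is defined by separate counts of triangles and decagons; comparing numbers
  of extreme points makes the two classes disjoint.\<close>

lemma not_triangle_and_decagon: "\<not> (regular_polygon 3 \<sigma> \<and> regular_polygon 10 \<sigma>)"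
proof
  assume "regular_polygon 3 \<sigma> \<and> regular_polygon 10 \<sigma>"
  then obtain f g where "polygon_cycle 3 \<sigma> f" "polygon_cycle 10 \<sigma> g"
    using regular_polygon_cycle by metis
  then show False unfolding polygon_cycle_def by simp
qed

section \<open>Vertices, edges and facets meeting at a vertex\<close>

locale trunc_dodec =
  fixes P :: "(real^3) set"
  assumes P: "truncated_dodecahedron P"
begin

lemma polytope_P: "polytope P" and aff_dim_P: "aff_dim P = 3"
  using P unfolding truncated_dodecahedron_def by auto

lemma facetD:
  assumes "\<sigma> \<in> facet_set P"
  shows "\<sigma> face_of P" "aff_dim \<sigma> = 2" "convex \<sigma>"
  using assms aff_dim_P unfolding facet_set_def facet_of_def by (auto dest: face_of_imp_convex)

text \<open>Nonempty proper faces of a polyhedron are intersections of facets; the dimension bound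
  separates \<open>E\<close> from \<open>P\<close>.\<close>

lemma face_eq_Inter_facets:
  assumes "E face_of P" "E \<noteq> {}" "aff_dim E \<le> 1"
  shows "E = \<Inter>{\<sigma> \<in> facet_set P. E \<subseteq> \<sigma>}"
proof -
  have "E \<noteq> P" using assms(3) aff_dim_P by auto
  then show ?thesis
    using face_of_polyhedron[OF polytope_imp_polyhedron[OF polytope_P] assms(1,2)]
    by (simp add: facet_set_def)
qed

lemma vertex_eq_Inter:
  assumes "x \<in> vertex_set P" "{\<sigma> \<in> facet_set P. x \<in> \<sigma>} = {A, B, C}"
  shows "A \<inter> B \<inter> C = {x}"
proof -
  have "{x} = \<Inter>{\<sigma> \<in> facet_set P. {x} \<subseteq> \<sigma>}"
    using assms(1) by (intro face_eq_Inter_facets) (simp_all add: vertex_set_def face_of_singleton)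
  also have "{\<sigma> \<in> facet_set P. {x} \<subseteq> \<sigma>} = {A, B, C}" using assms(2) by simp
  finally show ?thesis by auto
qed

text \<open>An edge is the intersection of the facets containing it, and these are among the three
  at \<open>x\<close>. A single facet has dimension 2 and all three meet only in \<open>x\<close>,
  so exactly two of them contain the edge.\<close>

lemma edge_cases:
  assumes x: "x \<in> vertex_set P" and ABC: "{\<sigma> \<in> facet_set P. x \<in> \<sigma>} = {A, B, C}"
    and e: "E edge_of P" "x \<in> E"
  shows "E = A \<inter> B \<or> E = A \<inter> C \<or> E = B \<inter> C"
proof -
  have E: "E face_of P" "aff_dim E = 1" using e unfolding edge_of_def by auto
  define \<S> where "\<S> = {\<sigma> \<in> facet_set P. E \<subseteq> \<sigma>}"
  have "E = \<Inter>{\<sigma> \<in> facet_set P. E \<subseteq> \<sigma>}"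
    by (rule face_eq_Inter_facets) (use E e(2) in auto)
  then have eq: "E = \<Inter>\<S>" unfolding \<S>_def .
  have sub: "\<S> \<subseteq> {A, B, C}" using ABC e(2) unfolding \<S>_def by blast
  have nofacet: "E \<notin> facet_set P" using E(2) facetD(2)[of E] by auto
  have single: "\<S> \<noteq> {\<sigma>}" for \<sigma>
  proof
    assume S: "\<S> = {\<sigma>}"
    then have "E = \<sigma>" using eq by simp
    moreover have "\<sigma> \<in> facet_set P" using S unfolding \<S>_def by blast
    ultimately show False using nofacet by simp
  qed
  have nonempty: "\<S> \<noteq> {}"
  proof
    assume "\<S> = {}"
    then have "E = UNIV" using eq by simp
    then show False using E(2) by simp
  qed
  have triple: "\<S> \<noteq> {A, B, C}"
  proof
    assume S: "\<S> = {A, B, C}"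
    have "E = A \<inter> B \<inter> C" using eq unfolding S by (simp add: Int_assoc)
    then have "E = {x}" using vertex_eq_Inter[OF x ABC] by simp
    then show False using E(2) by simp
  qed
  have "\<S> \<in> Pow {A, B, C}" using sub by simp
  then have "\<S> = {A, B} \<or> \<S> = {A, C} \<or> \<S> = {B, C}"
    using single[of A] single[of B] single[of C] nonempty triple
    unfolding Pow_insert Pow_empty by (elim UnE imageE) simp_all
  then show ?thesis
  proof (elim disjE)
    assume S: "\<S> = {A, B}" show ?thesis using eq unfolding S by simp
  next
    assume S: "\<S> = {A, C}" show ?thesis using eq unfolding S by simp
  next
    assume S: "\<S> = {B, C}" show ?thesis using eq unfolding S by simp
  qed
qed

text \<open>The edge lies in \<open>A\<close> by convexity, so if it were
  \<open>B \<inter> C\<close> it would lie in all three facets and shrink to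
  \<open>x\<close>.\<close>

lemma edge_in_facet:
  assumes x: "x \<in> vertex_set P" and ABC: "{\<sigma> \<in> facet_set P. x \<in> \<sigma>} = {A, B, C}"
    and e: "adjacent P x y" "y \<in> A"
  shows "closed_segment x y = A \<inter> B \<or> closed_segment x y = A \<inter> C"
proof -
  have A: "A \<in> facet_set P" "x \<in> A" using ABC by auto
  have sub: "closed_segment x y \<subseteq> A"
    using A e(2) facetD(3) by (intro closed_segment_subset) auto
  have "closed_segment x y \<noteq> B \<inter> C"
  proof
    assume "closed_segment x y = B \<inter> C"
    then have "closed_segment x y \<subseteq> {x}" using sub vertex_eq_Inter[OF x ABC] by blast
    then show False using adjacent_neq[OF e(1)] by auto
  qed
  then show ?thesis
    using edge_cases[OF x ABC, of "closed_segment x y"] e(1) unfolding adjacent_def by auto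
qed

lemma facet_cycle:
  assumes "\<sigma> \<in> facet_set P" "polygon_cycle n \<sigma> f"
  shows "{v \<in> vertex_set P. v \<in> \<sigma>} = range f"
    and "adjacent P (f k) (f (k + 1))" and "adjacent P (f k) (f (k - 1))"
proof -
  have face: "\<sigma> face_of P" using facetD assms(1) by blast
  show rng: "{v \<in> vertex_set P. v \<in> \<sigma>} = range f"
    using extreme_point_of_face[OF face] assms(2) unfolding polygon_cycle_def vertex_set_def by blast
  have *: "adjacent P (f k) (f (k + 1))" for k
  proof -
    have "closed_segment (f k) (f (k + 1)) edge_of P"
      using assms(2) face face_of_trans unfolding polygon_cycle_def edge_of_def by blast
    then show ?thesis using rng unfolding adjacent_def by blast
  qed
  show "adjacent P (f k) (f (k + 1))" by (rule *)
  show "adjacent P (f k) (f (k - 1))" using *[of "k - 1"] adjacent_sym by auto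
qed

lemma cycle_at_vertex:
  assumes "\<sigma> \<in> facet_set P" "polygon_cycle n \<sigma> f" "x \<in> vertex_set P" "x \<in> \<sigma>"
  obtains k where "x = f k"
  using facet_cycle(1)[OF assms(1,2)] assms(3,4) by blast

text \<open>The two polygon edges at \<open>x\<close> are distinct and each is one of the two
  intersections, so both intersections occur. This is what shows that neighbouring facets really
  meet in an edge.\<close>

lemma cycle_edges:
  assumes x: "x \<in> vertex_set P" and ABC: "{\<sigma> \<in> facet_set P. x \<in> \<sigma>} = {A, B, C}"
    and f: "polygon_cycle n A f" "x = f k"
  shows "{closed_segment x (f (k + 1)), closed_segment x (f (k - 1))} = {A \<inter> B, A \<inter> C}"
proof -
  have A: "A \<in> facet_set P" using ABC by auto
  have mem: "f j \<in> A" for j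
  proof -
    have "f j \<in> {v \<in> vertex_set P. v \<in> A}" unfolding facet_cycle(1)[OF A f(1)] by simp
    then show ?thesis by simp
  qed
  have adj: "adjacent P x (f (k + 1))" "adjacent P x (f (k - 1))"
    using facet_cycle(2,3)[OF A f(1), of k] f(2) by simp_all
  have ne: "f (k + 1) \<noteq> f (k - 1)" using f(1) unfolding polygon_cycle_def by simp
  have "closed_segment x (f (k + 1)) \<noteq> closed_segment x (f (k - 1))"
    using ne closed_segment_cancel by metis
  then show ?thesis
    using edge_in_facet[OF x ABC adj(1) mem] edge_in_facet[OF x ABC adj(2) mem]
    by (elim disjE) (simp_all only: insert_commute simp_thms)
qed

lemma cycle_neighbours:
  assumes x: "x \<in> vertex_set P" and ABC: "{\<sigma> \<in> facet_set P. x \<in> \<sigma>} = {A, B, C}"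
    and f: "polygon_cycle n A f" "x = f k" and y: "adjacent P x y" "y \<in> A"
  shows "y = f (k + 1) \<or> y = f (k - 1)"
proof -
  have "closed_segment x y \<in> {closed_segment x (f (k + 1)), closed_segment x (f (k - 1))}"
    using edge_in_facet[OF x ABC y] unfolding cycle_edges[OF x ABC f] by simp
  then show ?thesis by (auto dest: closed_segment_cancel simp del: closed_segment_eq)
qed

lemma cycle_edge:
  assumes x: "x \<in> vertex_set P" and ABC: "{\<sigma> \<in> facet_set P. x \<in> \<sigma>} = {A, B, C}"
    and reg: "regular_polygon n A"
  obtains y z where "adjacent P x y" "A \<inter> B = closed_segment x y"
    "adjacent P x z" "A \<inter> C = closed_segment x z"
proof -
  obtain f where f: "polygon_cycle n A f" using reg regular_polygon_cycle by blast
  have A: "A \<in> facet_set P" "x \<in> A" using ABC by auto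
  obtain k where k: "x = f k" using cycle_at_vertex[OF A(1) f x A(2)] .
  have adj: "adjacent P x (f (k + 1))" "adjacent P x (f (k - 1))"
    using facet_cycle(2,3)[OF A(1) f, of k] k by simp_all
  have "closed_segment x (f (k + 1)) = A \<inter> B \<and> closed_segment x (f (k - 1)) = A \<inter> C \<or>
        closed_segment x (f (k + 1)) = A \<inter> C \<and> closed_segment x (f (k - 1)) = A \<inter> B"
    using cycle_edges[OF x ABC f k] by (simp only: doubleton_eq_iff)
  then show ?thesis
    using that[of "f (k + 1)" "f (k - 1)"] that[of "f (k - 1)" "f (k + 1)"] adj by auto
qed

lemma corner_exists:
  assumes x: "x \<in> vertex_set P"
  obtains y1 y2 y3 T D1 D2 where "corner P x y1 y2 y3 T D1 D2"
proof -
  have tri: "card {\<sigma> \<in> facet_set P. x \<in> \<sigma> \<and> regular_polygon 3 \<sigma>} = 1"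
    and dec: "card {\<sigma> \<in> facet_set P. x \<in> \<sigma> \<and> regular_polygon 10 \<sigma>} = 2"
    and reg: "\<forall>\<sigma>\<in>facet_set P. regular_polygon 3 \<sigma> \<or> regular_polygon 10 \<sigma>"
    using P x unfolding truncated_dodecahedron_def by blast+
  obtain T where T: "{\<sigma> \<in> facet_set P. x \<in> \<sigma> \<and> regular_polygon 3 \<sigma>} = {T}"
    using card_1_singletonE[OF tri] .
  obtain D1 D2 where D: "{\<sigma> \<in> facet_set P. x \<in> \<sigma> \<and> regular_polygon 10 \<sigma>} = {D1, D2}" "D1 \<noteq> D2"
    using dec unfolding card_2_iff by blast
  have mem: "regular_polygon 3 T" "regular_polygon 10 D1" "regular_polygon 10 D2"
    using T D(1) by blast+
  have dist: "distinct [T, D1, D2]" using mem not_triangle_and_decagon D(2) by auto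
  have "{\<sigma> \<in> facet_set P. x \<in> \<sigma>} = {\<sigma> \<in> facet_set P. x \<in> \<sigma> \<and> regular_polygon 3 \<sigma>} \<union>
      {\<sigma> \<in> facet_set P. x \<in> \<sigma> \<and> regular_polygon 10 \<sigma>}" using reg by blast
  then have all: "{\<sigma> \<in> facet_set P. x \<in> \<sigma>} = {T, D1, D2}" unfolding T D(1) insert_is_Un[symmetric] .
  obtain y1 y2 where y12: "adjacent P x y1" "T \<inter> D1 = closed_segment x y1"
    "adjacent P x y2" "T \<inter> D2 = closed_segment x y2"
    using cycle_edge[OF x all mem(1)] .
  \<comment> \<open>With \<open>D1\<close> listed first, \<open>cycle_edge\<close> yields the edge
    \<open>D1 \<inter> D2\<close>.\<close>
  have all': "{\<sigma> \<in> facet_set P. x \<in> \<sigma>} = {D1, D2, T}" unfolding all by blast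
  obtain y3 where y3: "adjacent P x y3" "D1 \<inter> D2 = closed_segment x y3"
    using cycle_edge[OF x all' mem(2)] .
  show ?thesis
    by (rule that[of y1 y2 y3 T D1 D2])
      (use x all dist mem y12 y3 in \<open>simp add: corner_def\<close>)
qed

lemma corner_facets:
  assumes "corner P x y1 y2 y3 T D1 D2"
  shows "T \<in> facet_set P" "D1 \<in> facet_set P" "D2 \<in> facet_set P"
    "x \<in> T" "x \<in> D1" "x \<in> D2" "y1 \<in> T" "y1 \<in> D1" "y2 \<in> T" "y2 \<in> D2" "y3 \<in> D1" "y3 \<in> D2"
proof -
  have all: "{\<sigma> \<in> facet_set P. x \<in> \<sigma>} = {T, D1, D2}" using assms unfolding corner_def by simp
  then show "T \<in> facet_set P" "D1 \<in> facet_set P" "D2 \<in> facet_set P"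
    "x \<in> T" "x \<in> D1" "x \<in> D2" by auto
  have "y1 \<in> T \<inter> D1" "y2 \<in> T \<inter> D2" "y3 \<in> D1 \<inter> D2" using assms unfolding corner_def by auto
  then show "y1 \<in> T" "y1 \<in> D1" "y2 \<in> T" "y2 \<in> D2" "y3 \<in> D1" "y3 \<in> D2" by auto
qed

text \<open>A coincidence among the neighbours would put a point other than \<open>x\<close> into
  all three facets.\<close>

lemma corner_distinct:
  assumes c: "corner P x y1 y2 y3 T D1 D2"
  shows "y1 \<noteq> y2" "y1 \<noteq> y3" "y2 \<noteq> y3" "x \<noteq> y1" "x \<noteq> y2" "x \<noteq> y3"
proof -
  have "x \<in> vertex_set P" "{\<sigma> \<in> facet_set P. x \<in> \<sigma>} = {T, D1, D2}"
    and adj: "adjacent P x y1" "adjacent P x y2" "adjacent P x y3"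
    using c unfolding corner_def by simp_all
  then have i: "T \<inter> D1 \<inter> D2 = {x}" by (intro vertex_eq_Inter)
  show ne: "x \<noteq> y1" "x \<noteq> y2" "x \<noteq> y3" using adj[THEN adjacent_neq] .
  have "y \<in> T \<Longrightarrow> y \<in> D1 \<Longrightarrow> y \<in> D2 \<Longrightarrow> y = x" for y using i by blast
  then show "y1 \<noteq> y2" "y1 \<noteq> y3" "y2 \<noteq> y3"
    using corner_facets[OF c] ne by metis+
qed

section \<open>Transport of corners along edges\<close>

lemma triangle_unique:
  assumes "x \<in> vertex_set P" "\<sigma> \<in> facet_set P" "x \<in> \<sigma>" "regular_polygon 3 \<sigma>"
    "\<tau> \<in> facet_set P" "x \<in> \<tau>" "regular_polygon 3 \<tau>"
  shows "\<sigma> = \<tau>"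
proof -
  have "card {\<sigma> \<in> facet_set P. x \<in> \<sigma> \<and> regular_polygon 3 \<sigma>} = 1"
    using P assms(1) unfolding truncated_dodecahedron_def by blast
  then obtain T where "{\<sigma> \<in> facet_set P. x \<in> \<sigma> \<and> regular_polygon 3 \<sigma>} = {T}"
    by (rule card_1_singletonE)
  moreover have "\<sigma> \<in> {\<sigma> \<in> facet_set P. x \<in> \<sigma> \<and> regular_polygon 3 \<sigma>}"
    "\<tau> \<in> {\<sigma> \<in> facet_set P. x \<in> \<sigma> \<and> regular_polygon 3 \<sigma>}" using assms by simp_all
  ultimately show ?thesis by simp
qed

text \<open>A path in a decagon that never turns back visits four consecutive vertices of its cycle.
  The recurrence is unchanged when the cycle is reversed, so both directions give the same
  formula.\<close>

lemma decagon_path: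
  assumes D: "D \<in> facet_set P" "regular_polygon 10 D"
    and path: "adjacent P a b" "adjacent P b c" "adjacent P c d"
    and mem: "a \<in> D" "b \<in> D" "c \<in> D" "d \<in> D" and ne: "a \<noteq> c" "b \<noteq> d"
  shows "d = c + golden *\<^sub>R (c - b) - (b - a)"
proof -
  obtain f where f: "polygon_cycle 10 D f" using D(2) regular_polygon_cycle by blast
  have rec: "f (k + 2) - f (k + 1) = golden *\<^sub>R (f (k + 1) - f k) - (f k - f (k - 1))" for k
    using f unfolding polygon_cycle_def golden_def by simp
  have nb: "y = f (k + 1) \<or> y = f (k - 1)" if "adjacent P (f k) y" "y \<in> D" for y k
  proof -
    have "f k \<in> {v \<in> vertex_set P. v \<in> D}" unfolding facet_cycle(1)[OF D(1) f] by simp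
    then have v: "f k \<in> vertex_set P" "f k \<in> D" by simp_all
    obtain y1 y2 y3 T D1 D2 where c: "corner P (f k) y1 y2 y3 T D1 D2"
      using corner_exists[OF v(1)] .
    have all: "{\<sigma> \<in> facet_set P. f k \<in> \<sigma>} = {T, D1, D2}" using c unfolding corner_def by simp
    have "D \<in> {\<sigma> \<in> facet_set P. f k \<in> \<sigma>}" using D v by simp
    then have "D = T \<or> D = D1 \<or> D = D2" unfolding all by simp
    then obtain B C where "{T, D1, D2} = {D, B, C}" by (metis insert_commute)
    then show ?thesis using cycle_neighbours[OF v(1) _ f refl that] all by simp
  qed
  have v: "b \<in> vertex_set P" using path(2) unfolding adjacent_def by simp
  obtain k where k: "b = f k" using cycle_at_vertex[OF D(1) f v mem(2)] .
  have "a = f (k + 1) \<or> a = f (k - 1)" "c = f (k + 1) \<or> c = f (k - 1)"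
    using nb[of k] adjacent_sym[OF path(1)] path(2) mem unfolding k by auto
  then consider "a = f (k - 1)" "c = f (k + 1)" | "a = f (k + 1)" "c = f (k - 1)"
    using ne(1) by auto
  then show ?thesis
  proof cases
    case 1
    have "d = f (k + 1 + 1) \<or> d = f (k + 1 - 1)"
      using nb[of "k + 1"] path(3) mem unfolding 1 by blast
    then have "d = f (k + 2)" using ne(2) k by (auto simp: add.commute)
    then show ?thesis using rec[of k] 1 k by (simp add: algebra_simps)
  next
    case 2
    have "d = f (k - 1 + 1) \<or> d = f (k - 1 - 1)"
      using nb[of "k - 1"] path(3) mem unfolding 2 by blast
    then have d: "d = f (k - 2)" using ne(2) k by auto
    have "f (k + 1) - f k = golden *\<^sub>R (f k - f (k - 1)) - (f (k - 1) - f (k - 2))"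
      using rec[of "k - 1"] by (simp add: add.commute)
    then show ?thesis using d 2 k by (simp add: algebra_simps)
  qed
qed

text \<open>Moving along a triangle edge keeps \<open>T\<close> and \<open>D1\<close>. A triangle
  has only three vertices, so the other triangle neighbour of \<open>y1\<close> is
  \<open>y2\<close>; the third neighbour of \<open>y1\<close> continues the path from
  \<open>y3\<close> through \<open>x\<close> and \<open>y1\<close> in \<open>D1\<close>.\<close>

lemma corner_step_triangle:
  assumes c: "corner P x y1 y2 y3 T D1 D2"
  shows "\<exists>D3. corner P y1 x y2 (y1 + golden *\<^sub>R (y1 - x) - (x - y3)) T D1 D3"
proof -
  note cD = cornerD[OF c] and fac = corner_facets[OF c] and dis = corner_distinct[OF c]
  have v: "y1 \<in> vertex_set P" "y2 \<in> vertex_set P" "x \<in> vertex_set P"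
    using cD(8,9,10) unfolding adjacent_def by simp_all
  obtain u1 u2 u3 T' D1' D2' where c0: "corner P y1 u1 u2 u3 T' D1' D2'"
    using corner_exists[OF v(1)] .
  have T': "T' = T"
    by (rule triangle_unique[OF v(1) corner_facets(1,4)[OF c0] cornerD(5)[OF c0] fac(1,7) cD(5)])
  have "D1 = D1' \<or> D1 = D2'"
    using cornerD(14)[OF c0 fac(2,8)] cD(2) T' by simp
  then obtain w1 w2 w3 D3 where c': "corner P y1 w1 w2 w3 T D1 D3"
    using c0 corner_swap[OF c0] unfolding T' by blast
  note cD' = cornerD[OF c'] and fac' = corner_facets[OF c'] and dis' = corner_distinct[OF c']
  have "closed_segment y1 w1 = closed_segment y1 x"
    using cD(11) cD'(11) closed_segment_commute by metis
  then have w1: "w1 = x" by (rule closed_segment_cancel)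
  have v': "w2 \<in> vertex_set P" using cD'(9) unfolding adjacent_def by simp
  have w2: "w2 = y2"
  proof (rule ccontr)
    assume "w2 \<noteq> y2"
    then have 4: "card {x, y1, y2, w2} = 4" using dis dis' w1 by auto
    obtain f where f: "polygon_cycle 3 T f" using cD(5) regular_polygon_cycle by blast
    have fin: "card (range f) = 3" using f unfolding polygon_cycle_def by simp
    then have "finite (range f)" by (intro card_ge_0_finite) simp
    moreover have "{x, y1, y2, w2} \<subseteq> range f"
      unfolding facet_cycle(1)[OF fac(1) f, symmetric] using v v' fac fac' by simp
    ultimately show False using card_mono[of "range f" "{x, y1, y2, w2}"] 4 fin by simp
  qed
  have "w3 = y1 + golden *\<^sub>R (y1 - x) - (x - y3)"
    using dis dis' unfolding w1
    by (intro decagon_path[OF fac(2) cD(6) adjacent_sym[OF cD(10)] cD(8) cD'(10) fac(11,5,8) fac'(11)])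
      simp_all
  then show ?thesis using c' unfolding w1 w2 by blast
qed

text \<open>Moving along the edge between the decagons keeps both of them. Each new triangle
  neighbour continues a path through \<open>x\<close> and \<open>y3\<close>, in \<open>D1\<close>
  from \<open>y1\<close> and in \<open>D2\<close> from \<open>y2\<close>.\<close>

lemma corner_step_decagon:
  assumes c: "corner P x y1 y2 y3 T D1 D2"
  shows "\<exists>T'. corner P y3 (y3 + golden *\<^sub>R (y3 - x) - (x - y1))
                          (y3 + golden *\<^sub>R (y3 - x) - (x - y2)) x T' D1 D2"
proof -
  note cD = cornerD[OF c] and fac = corner_facets[OF c] and dis = corner_distinct[OF c]
  have v: "y3 \<in> vertex_set P"
    using cD(10) unfolding adjacent_def by simp
  obtain u1 u2 u3 T' D1' D2' where c0: "corner P y3 u1 u2 u3 T' D1' D2'"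
    using corner_exists[OF v] .
  have "D \<noteq> T'" if "regular_polygon 10 D" for D
    using not_triangle_and_decagon cornerD(5)[OF c0] that by blast
  then have "D1 = D1' \<and> D2 = D2' \<or> D1 = D2' \<and> D2 = D1'"
    using cornerD(14)[OF c0 fac(2,11)] cornerD(14)[OF c0 fac(3,12)] cD(4,6,7) by blast
  then obtain w1 w2 w3 where c': "corner P y3 w1 w2 w3 T' D1 D2"
    using c0 corner_swap[OF c0] by blast
  note cD' = cornerD[OF c'] and fac' = corner_facets[OF c'] and dis' = corner_distinct[OF c']
  have "closed_segment y3 w3 = closed_segment y3 x"
    using cD(13) cD'(13) closed_segment_commute by metis
  then have w3: "w3 = x" by (rule closed_segment_cancel)
  have "w1 = y3 + golden *\<^sub>R (y3 - x) - (x - y1)"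
    using dis dis' unfolding w3
    by (intro decagon_path[OF fac(2) cD(6) adjacent_sym[OF cD(8)] cD(10) cD'(8) fac(8,5,11) fac'(8)])
      simp_all
  moreover have "w2 = y3 + golden *\<^sub>R (y3 - x) - (x - y2)"
    using dis dis' unfolding w3
    by (intro decagon_path[OF fac(3) cD(7) adjacent_sym[OF cD(9)] cD(10) cD'(9) fac(10,6,12) fac'(10)])
      simp_all
  ultimately show ?thesis using c' unfolding w3 by blast
qed

lemma adjacent_corner:
  assumes c: "corner P x y1 y2 y3 T D1 D2" and "adjacent P x y"
  shows "y \<in> {y1, y2, y3}"
proof -
  have "{\<sigma> \<in> facet_set P. x \<in> \<sigma>} = {T, D1, D2}" using c unfolding corner_def by simp
  then have "closed_segment x y = closed_segment x y1 \<or> closed_segment x y = closed_segment x y2 \<or>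
      closed_segment x y = closed_segment x y3"
    using edge_cases[OF cornerD(1)[OF c], of T D1 D2 "closed_segment x y"] assms(2)
    unfolding cornerD(11-13)[OF c] adjacent_def by simp
  then show ?thesis using closed_segment_cancel by blast
qed

text \<open>Equality of edge lengths alone yields the angles of 60 and 144 degrees. The third side
  of the triangle gives the first; the edge leaving \<open>y1\<close> or \<open>y2\<close> in a
  decagon is known by extrapolation, and its length gives the second.\<close>

lemma corner_gram:
  assumes c: "corner P x y1 y2 y3 T D1 D2"
  obtains q where "q > 0"
    "(y1 - x) \<bullet> (y1 - x) = q" "(y2 - x) \<bullet> (y2 - x) = q" "(y3 - x) \<bullet> (y3 - x) = q"
    "(y1 - x) \<bullet> (y2 - x) = q / 2" "(y1 - x) \<bullet> (y3 - x) = - golden * q / 2"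
    "(y2 - x) \<bullet> (y3 - x) = - golden * q / 2"
proof -
  obtain l where "\<forall>x y. adjacent P x y \<longrightarrow> dist x y = l"
    using P unfolding truncated_dodecahedron_def by blast
  then have l: "(y - x) \<bullet> (y - x) = l * l" if "adjacent P x y" for x y
    using that by (metis dist_commute dist_norm norm_eq_sqrt_inner power2_norm_eq_inner power2_eq_square)
  define q where "q = l * l"
  have adj: "adjacent P x y1" "adjacent P x y2" "adjacent P x y3"
    using cornerD[OF c] by simp_all
  have 1: "(y1 - x) \<bullet> (y1 - x) = q" "(y2 - x) \<bullet> (y2 - x) = q" "(y3 - x) \<bullet> (y3 - x) = q"
    unfolding q_def using l adj by auto
  \<comment> \<open>Stated for arbitrary labels so that it also applies to the swapped
    corner.\<close>
  have gd: "(b - x) \<bullet> (y3 - x) = - golden * q / 2" if cc: "corner P x b b' y3 T D D'" for b b' D D'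
  proof -
    have "adjacent P b (b + golden *\<^sub>R (b - x) - (x - y3))" "adjacent P x b"
      using corner_step_triangle[OF cc] cornerD(8)[OF cc] cornerD(10) by blast+
    then have z: "(golden *\<^sub>R (b - x) + (y3 - x)) \<bullet> (golden *\<^sub>R (b - x) + (y3 - x)) = q"
        "(b - x) \<bullet> (b - x) = q"
      using l unfolding q_def by (fastforce simp: algebra_simps)+
    define s t where "s = b - x" and "t = y3 - x"
    have "(golden *\<^sub>R s + t) \<bullet> (golden *\<^sub>R s + t) = golden * golden * (s \<bullet> s) + 2 * golden * (s \<bullet> t) + t \<bullet> t"
      by (simp add: inner_add_left inner_add_right inner_commute[of t s] algebra_simps)
    moreover have st: "(golden *\<^sub>R s + t) \<bullet> (golden *\<^sub>R s + t) = q" "s \<bullet> s = q" "t \<bullet> t = q"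
      using z 1(3) unfolding s_def t_def by simp_all
    ultimately have "golden * golden * q + 2 * golden * (s \<bullet> t) + q = q" by metis
    then have "golden * (golden * q + 2 * (s \<bullet> t)) = 0" by (simp add: algebra_simps)
    then have "golden * q + 2 * (s \<bullet> t) = 0" using golden_pos by simp
    then show ?thesis unfolding s_def t_def by simp
  qed
  have "adjacent P y1 y2"
    using corner_step_triangle[OF c] cornerD(9) by blast
  then have "((y2 - x) - (y1 - x)) \<bullet> ((y2 - x) - (y1 - x)) = q"
    using l unfolding q_def by simp
  moreover have "(t - s) \<bullet> (t - s) = t \<bullet> t - 2 * (s \<bullet> t) + s \<bullet> s" for s t :: "real^3"
    by (simp add: inner_diff_left inner_diff_right inner_commute[of t s])
  ultimately have 2: "(y1 - x) \<bullet> (y2 - x) = q / 2"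
    using 1 by (simp only:)
  have "q > 0" using 1(1) corner_distinct(4)[OF c] by (metis inner_gt_zero_iff right_minus_eq)
  then show ?thesis
    using that 1 2 gd[OF c] gd[OF corner_swap[OF c]] by blast
qed

lemma finite_vertex_set: "finite (vertex_set P)"
  using finite_polyhedron_extreme_points[OF polytope_imp_polyhedron[OF polytope_P]]
  unfolding vertex_set_def by simp

text \<open>Every vertex lies on one of the 20 triangles. The bound later forces the sixty model
  points to be all the vertices.\<close>

lemma card_vertex_set: "card (vertex_set P) \<le> 60"
proof -
  let ?T = "{\<sigma> \<in> facet_set P. regular_polygon 3 \<sigma>}"
  have T: "card ?T = 20" using P unfolding truncated_dodecahedron_def by blast
  then have fin: "finite ?T" by (intro card_ge_0_finite) simp
  have 3: "card {v \<in> vertex_set P. v \<in> \<sigma>} = 3" if "\<sigma> \<in> ?T" for \<sigma>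
  proof -
    have \<sigma>: "\<sigma> \<in> facet_set P" "regular_polygon 3 \<sigma>" using that by simp_all
    obtain f where f: "polygon_cycle 3 \<sigma> f" using regular_polygon_cycle[OF \<sigma>(2)] .
    then show ?thesis unfolding facet_cycle(1)[OF \<sigma>(1) f] polygon_cycle_def by simp
  qed
  have "vertex_set P \<subseteq> (\<Union>\<sigma>\<in>?T. {v \<in> vertex_set P. v \<in> \<sigma>})"
  proof
    fix x assume x: "x \<in> vertex_set P"
    then obtain y1 y2 y3 T D1 D2 where c: "corner P x y1 y2 y3 T D1 D2" by (rule corner_exists)
    then show "x \<in> (\<Union>\<sigma>\<in>?T. {v \<in> vertex_set P. v \<in> \<sigma>})"
      using x corner_facets(1,4)[OF c] cornerD(5)[OF c] by blast
  qed
  then have "card (vertex_set P) \<le> card (\<Union>\<sigma>\<in>?T. {v \<in> vertex_set P. v \<in> \<sigma>})"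
    using fin finite_vertex_set by (intro card_mono) auto
  also have "\<dots> \<le> (\<Sum>\<sigma>\<in>?T. card {v \<in> vertex_set P. v \<in> \<sigma>})" by (rule card_UN_le[OF fin])
  also have "\<dots> = (\<Sum>\<sigma>\<in>?T. 3)" by (rule sum.cong[OF refl 3])
  also have "\<dots> = 60" using T by simp
  finally show ?thesis .
qed

lemma facet_has_vertex:
  assumes "\<sigma> \<in> facet_set P"
  obtains x where "x \<in> vertex_set P" "x \<in> \<sigma>"
proof -
  have "regular_polygon 3 \<sigma> \<or> regular_polygon 10 \<sigma>"
    using P assms unfolding truncated_dodecahedron_def by blast
  then obtain n f where "polygon_cycle n \<sigma> f" using regular_polygon_cycle by metis
  then show ?thesis using facet_cycle(1)[OF assms] that by blast
qed

lemma vertex_exists: obtains x where "x \<in> vertex_set P"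
proof -
  have "card {\<sigma> \<in> facet_set P. regular_polygon 3 \<sigma>} = 20"
    using P unfolding truncated_dodecahedron_def by blast
  then have "{\<sigma> \<in> facet_set P. regular_polygon 3 \<sigma>} \<noteq> {}" by force
  then show ?thesis using facet_has_vertex that by blast
qed

end

subsection \<open>Coordinates in the ring of golden integers\<close>

text \<open>The pair \<open>(a, b)\<close> stands for \<open>a + b * golden\<close>.\<close>

type_synonym gint = "int \<times> int"
type_synonym gvec = "gint \<times> gint \<times> gint"

fun gadd :: "gint \<Rightarrow> gint \<Rightarrow> gint" where
  "gadd (a, b) (c, d) = (a + c, b + d)"

fun gneg :: "gint \<Rightarrow> gint" where
  "gneg (a, b) = (- a, - b)"

fun gmul :: "gint \<Rightarrow> gint \<Rightarrow> gint" where
  "gmul (a, b) (c, d) = (a * c + b * d, a * d + b * c + b * d)"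

fun vadd :: "gvec \<Rightarrow> gvec \<Rightarrow> gvec" where
  "vadd (x, y, z) (x', y', z') = (gadd x x', gadd y y', gadd z z')"

fun vscale :: "gint \<Rightarrow> gvec \<Rightarrow> gvec" where
  "vscale k (x, y, z) = (gmul k x, gmul k y, gmul k z)"

definition vdiff :: "gvec \<Rightarrow> gvec \<Rightarrow> gvec" where
  "vdiff v w = vadd v (vscale (- 1, 0) w)"

fun gdot :: "gvec \<Rightarrow> gvec \<Rightarrow> gint" where
  "gdot (x, y, z) (x', y', z') = gadd (gmul x x') (gadd (gmul y y') (gmul z z'))"

fun gdet :: "gvec \<Rightarrow> gvec \<Rightarrow> gvec \<Rightarrow> gint" where
  "gdet (a, b, c) (d, e, f) (g, h, i) =
     gadd (gmul a (gadd (gmul e i) (gneg (gmul f h))))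
       (gadd (gmul b (gadd (gmul f g) (gneg (gmul d i))))
         (gmul c (gadd (gmul d h) (gneg (gmul e g)))))"

definition gval :: "gint \<Rightarrow> real" where
  "gval a = of_int (fst a) + golden * of_int (snd a)"

lemma gval_gadd: "gval (gadd a b) = gval a + gval b"
  by (cases a; cases b) (simp add: gval_def algebra_simps)

lemma gval_gneg: "gval (gneg a) = - gval a"
  by (cases a) (simp add: gval_def algebra_simps)

lemma gval_gmul: "gval (gmul a b) = gval a * gval b"
proof (cases a, cases b)
  fix x y z w assume "a = (x, y)" "b = (z, w)"
  moreover have "(of_int x + golden * of_int y) * (of_int z + golden * of_int w)
      = of_int (x * z) + golden * of_int (x * w + y * z) + (golden * golden) * of_int (y * w)"
    by (simp add: algebra_simps)
  ultimately show ?thesis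
    unfolding golden_sq by (simp add: gval_def algebra_simps)
qed

text \<open>Irrationality of the square root of 5, by infinite descent.\<close>

lemma sq_eq_5_sq_imp_zero:
  fixes x y :: int
  assumes "x * x = 5 * (y * y)"
  shows "y = 0"
  using assms
proof (induction "nat \<bar>y\<bar>" arbitrary: x y rule: less_induct)
  case less
  show ?case
  proof (rule ccontr)
    assume y: "y \<noteq> 0"
    have p5: "prime (5 :: int)" by simp
    have "5 dvd x * x" using less.prems by simp
    then have "5 dvd x" using p5 by (simp add: prime_dvd_mult_iff)
    then obtain k where k: "x = 5 * k" by blast
    have yk: "y * y = 5 * (k * k)" using less.prems k by simp
    then have "5 dvd y * y" by simp
    then have "5 dvd y" using p5 by (simp add: prime_dvd_mult_iff)
    then obtain m where m: "y = 5 * m" by blast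
    have "k * k = 5 * (m * m)" using yk m by simp
    moreover have "nat \<bar>m\<bar> < nat \<bar>y\<bar>" using y m by simp
    ultimately have "m = 0" using less.hyps by blast
    then show False using y m by simp
  qed
qed

text \<open>As \<open>2 * golden - 1\<close> is a square root of 5, a vanishing value makes
  \<open>(2 * x + y)\<close> squared equal to 5 times \<open>y\<close> squared. Real equations thus
  become decidable equations between integer pairs.\<close>

lemma gval_eq_0: "gval a = 0 \<longleftrightarrow> a = (0, 0)"
proof
  assume a: "gval a = 0"
  obtain x y where xy: "a = (x, y)" by (cases a)
  define X Y where "X = real_of_int x" and "Y = real_of_int y"
  have X: "X = - golden * Y" using a unfolding xy gval_def X_def Y_def by simp
  have "(2 * X + Y) * (2 * X + Y) = (4 * (golden * golden) - 4 * golden + 1) * (Y * Y)"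
    unfolding X by (simp add: algebra_simps)
  also have "\<dots> = 5 * (Y * Y)" unfolding golden_sq by simp
  finally have "real_of_int ((2 * x + y) * (2 * x + y)) = real_of_int (5 * (y * y))"
    unfolding X_def Y_def by simp
  then have "(2 * x + y) * (2 * x + y) = 5 * (y * y)" by (simp only: of_int_eq_iff)
  then have "y = 0" by (rule sq_eq_5_sq_imp_zero)
  then show "a = (0, 0)" using X unfolding xy X_def Y_def by simp
qed (simp add: gval_def)

lemma gval_inject: "gval a = gval b \<longleftrightarrow> a = b"
proof -
  have "gval a = gval b \<longleftrightarrow> gval (gadd a (gneg b)) = 0"
    by (simp add: gval_gadd gval_gneg)
  also have "\<dots> \<longleftrightarrow> a = b"
    unfolding gval_eq_0 by (cases a; cases b) auto
  finally show ?thesis .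
qed

subsection \<open>The model\<close>

text \<open>A flag consists of a vertex, its two neighbours in the triangle, and its third neighbour.\<close>

type_synonym flag = "gvec \<times> gvec \<times> gvec \<times> gvec"

text \<open>The three moves copy \<open>corner_swap\<close>, \<open>corner_step_triangle\<close> and
  \<open>corner_step_decagon\<close> in coordinates.\<close>

fun flag_swap :: "flag \<Rightarrow> flag" where
  "flag_swap (v, a, b, c) = (v, b, a, c)"

fun flag_triangle :: "flag \<Rightarrow> flag" where
  "flag_triangle (v, a, b, c) = (a, v, b, vdiff (vadd a (vscale (0, 1) (vdiff a v))) (vdiff v c))"

fun flag_decagon :: "flag \<Rightarrow> flag" where
  "flag_decagon (v, a, b, c) =
     (c, vdiff (vadd c (vscale (0, 1) (vdiff c v))) (vdiff v a),
         vdiff (vadd c (vscale (0, 1) (vdiff c v))) (vdiff v b), v)"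

text \<open>Letters 0 and 1 move to the first and second triangle neighbour, any other letter to the
  third neighbour.\<close>

fun flag_walk :: "flag \<Rightarrow> nat list \<Rightarrow> flag list" where
  "flag_walk q [] = [q]" |
  "flag_walk q (s # ss) = q # flag_walk
     (if s = 0 then flag_triangle q
      else if s = 1 then flag_triangle (flag_swap q) else flag_decagon q) ss"

text \<open>A vertex with its neighbours in the classical coordinates of the truncated dodecahedron
  of edge length \<open>2 * golden - 2\<close>.\<close>

definition base_flag :: flag where
  "base_flag = (((0, 0), (- 1, 1), (2, 1)), ((- 1, 1), (0, 1), (0, 2)),
                ((1, - 1), (0, 1), (0, 2)), ((0, 0), (1, - 1), (2, 1)))"

text \<open>The word traces a Hamiltonian path in the edge graph.\<close>

definition model_flags :: "flag list" where
  "model_flags = flag_walk base_flag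
     [0,1,2,0,1,2,0,1,2,0,1,2,1,1,2,0,1,2,0,1,2,1,1,2,1,1,2,1,1,
      2,1,1,2,1,1,2,0,1,2,0,1,2,1,1,2,0,1,2,0,1,2,1,1,2,1,1,2,0,1]"

definition model_vertices :: "gvec list" where
  "model_vertices = map fst model_flags"

text \<open>The motion is invariant under cyclic shifts and even sign changes and is negated by the
  central inversion, whence the products of signs in its first-order components. An entry
  \<open>(v, p', p'')\<close> is a vertex with its velocity and acceleration; an entry \<open>(n, d, a', a'')\<close>
  is a facet in the plane \<open>x \<bullet> n = d\<close>, whose normal \<open>n / d\<close> has the derivatives
  \<open>a' / d\<close> and \<open>a'' / d\<close>.\<close>

fun rotate_vec :: "gvec \<Rightarrow> gvec" where
  "rotate_vec (x, y, z) = (y, z, x)"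

fun sign_vec :: "int \<times> int \<times> int \<Rightarrow> gvec \<Rightarrow> gvec" where
  "sign_vec (r, s, t) (x, y, z) = (gmul (r, 0) x, gmul (s, 0) y, gmul (t, 0) z)"

fun sign_prod :: "int \<times> int \<times> int \<Rightarrow> int \<times> int \<times> int" where
  "sign_prod (r, s, t) = (s * t, t * r, r * s)"

definition signs :: "(int \<times> int \<times> int) list" where
  "signs = [(1,1,1), (1,1,-1), (1,-1,1), (1,-1,-1), (-1,1,1), (-1,1,-1), (-1,-1,1), (-1,-1,-1)]"

definition rotations :: "(gvec \<Rightarrow> gvec) list" where
  "rotations = [\<lambda>v. v, rotate_vec, \<lambda>v. rotate_vec (rotate_vec v)]"

text \<open>The base entries represent vertex orbits of sizes 12, 24 and 24. Vertices of the first
  orbit are listed twice, consistently: the sign of the zero coordinate affects only components that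
  vanish.\<close>

definition vertex_motion :: "(gvec \<times> gvec \<times> gvec) list" where
  "vertex_motion =
     [(sign_vec s (r v), sign_vec (sign_prod s) (r p1), sign_vec s (r p2)).
       (v, p1, p2) \<leftarrow>
         [(((0,0), (-1,1), (2,1)), ((24,16), (0,0), (0,0)), ((0,0), (-1024,-1856), (-1800,-2960))),
          (((-1,1), (0,1), (0,2)), ((20,28), (-20,16), (8,20)), ((-336,-1456), (-232,-2296), (-1240,-2792))),
          (((0,1), (2,0), (1,1)), ((2,38), (-2,28), (12,30)), ((-406,-1840), (-596,-2018), (-486,-2106)))],
       r \<leftarrow> rotations, s \<leftarrow> signs]"

text \<open>The base entries represent the 12 decagons and orbits of 8 and 12 triangles.\<close>

definition facet_motion :: "(gvec \<times> gint \<times> gvec \<times> gvec) list" where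
  "facet_motion =
     [(sign_vec s (r n), d, sign_vec (sign_prod s) (r a1), sign_vec s (r a2)).
       (n, d, a1, a2) \<leftarrow>
         [(((0,0), (0,1), (1,0)), (1,3), ((-16,-40), (0,0), (0,0)), ((0,0), (824,1312), (1408,2552))),
          (((1,0), (1,0), (1,0)), (3,2), ((12,-24), (12,-24), (12,-24)), ((1032,1356), (1032,1356), (1032,1356))),
          (((0,0), (-1,1), (0,1)), (3,2), ((-8,-64), (0,0), (0,0)), ((0,0), (688,2248), (704,3256)))],
       r \<leftarrow> rotations, s \<leftarrow> signs]"

text \<open>The default is arbitrary: all model vertices are in the table.\<close>

definition vertex_motion_of :: "gvec \<Rightarrow> gvec \<times> gvec" where
  "vertex_motion_of v = (case map_of vertex_motion v of Some m \<Rightarrow> m | None \<Rightarrow> (v, v))"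

fun edge_ok :: "gvec \<times> gvec \<times> gvec \<Rightarrow> gvec \<times> gvec \<times> gvec \<Rightarrow> bool" where
  "edge_ok (v, p1, p2) (w, q1, q2) \<longleftrightarrow>
     gdot (vdiff v w) (vdiff p1 q1) = (0, 0) \<and>
     gadd (gdot (vdiff v w) (vdiff p2 q2)) (gdot (vdiff p1 q1) (vdiff p1 q1)) = (0, 0)"

fun flag_edges_ok :: "flag \<Rightarrow> bool" where
  "flag_edges_ok (v, a, b, c) \<longleftrightarrow>
     edge_ok (v, vertex_motion_of v) (a, vertex_motion_of a) \<and>
     edge_ok (v, vertex_motion_of v) (b, vertex_motion_of b) \<and>
     edge_ok (v, vertex_motion_of v) (c, vertex_motion_of c)"

text \<open>The incidence equations with the common denominator \<open>d\<close> cleared.\<close>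

fun incidence_ok :: "gvec \<times> gvec \<times> gvec \<Rightarrow> gvec \<times> gint \<times> gvec \<times> gvec \<Rightarrow> bool" where
  "incidence_ok (v, p1, p2) (n, d, a1, a2) \<longleftrightarrow>
     (if gdot v n = d then
       gadd (gdot v a1) (gdot p1 n) = (0, 0) \<and>
       gadd (gdot v a2) (gadd (gmul (2, 0) (gdot p1 a1)) (gdot p2 n)) = (0, 0) else True)"

text \<open>Three linearly independent vertices determine the normal of a facet through them, so one
  listed plane through all three identifies it.\<close>

fun plane_ok :: "gvec \<Rightarrow> gvec \<Rightarrow> gvec \<Rightarrow> bool" where
  "plane_ok u v w \<longleftrightarrow> gdet u v w \<noteq> (0, 0) \<and>
     list_ex (\<lambda>(n, d, _). gdot u n = d \<and> gdot v n = d \<and> gdot w n = d) facet_motion"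

fun flag_planes_ok :: "flag \<Rightarrow> bool" where
  "flag_planes_ok (v, a, b, c) \<longleftrightarrow> plane_ok v a b \<and> plane_ok v a c \<and> plane_ok v b c"

section \<open>Finite checks on the model\<close>

lemma model_vertices_distinct: "distinct model_vertices" "length model_vertices = 60"
  by code_simp+

lemma model_vertices_sum: "fold vadd model_vertices ((0, 0), (0, 0), (0, 0)) = ((0, 0), (0, 0), (0, 0))"
  by code_simp

lemma model_edges_ok: "list_all flag_edges_ok model_flags"
  by code_simp

lemma model_planes_ok: "list_all flag_planes_ok model_flags"
  by code_simp

lemma model_incidences_ok:
  "list_all (\<lambda>v. list_all (incidence_ok (v, vertex_motion_of v)) facet_motion) model_vertices"
  by code_simp

subsection \<open>Realization of the model\<close>

fun frame :: "real^3 \<Rightarrow> real^3 \<Rightarrow> real^3 \<Rightarrow> gvec \<Rightarrow> real^3" where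
  "frame e1 e2 e3 (x, y, z) = gval x *\<^sub>R e1 + gval y *\<^sub>R e2 + gval z *\<^sub>R e3"

text \<open>The common squared length \<open>m\<close> stays free because the size of the polytope
  is not fixed.\<close>

definition orthogonal_frame :: "real \<Rightarrow> real^3 \<Rightarrow> real^3 \<Rightarrow> real^3 \<Rightarrow> bool" where
  "orthogonal_frame m e1 e2 e3 \<longleftrightarrow> 0 < m \<and> e1 \<bullet> e1 = m \<and> e2 \<bullet> e2 = m \<and> e3 \<bullet> e3 = m \<and>
     e1 \<bullet> e2 = 0 \<and> e1 \<bullet> e3 = 0 \<and> e2 \<bullet> e3 = 0"

lemma frame_vadd: "frame e1 e2 e3 (vadd v w) = frame e1 e2 e3 v + frame e1 e2 e3 w"
  by (cases v rule: prod_cases3; cases w rule: prod_cases3) (simp add: gval_gadd scaleR_add_left)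

lemma frame_vscale: "frame e1 e2 e3 (vscale k v) = gval k *\<^sub>R frame e1 e2 e3 v"
  by (cases v rule: prod_cases3) (simp add: gval_gmul scaleR_add_right)

lemma frame_vdiff: "frame e1 e2 e3 (vdiff v w) = frame e1 e2 e3 v - frame e1 e2 e3 w"
  by (simp add: vdiff_def frame_vadd frame_vscale gval_def)

lemma frame_zero: "frame e1 e2 e3 ((0, 0), (0, 0), (0, 0)) = 0"
  by (simp add: gval_def)

lemma frame_gdot:
  assumes "orthogonal_frame m e1 e2 e3"
  shows "frame e1 e2 e3 v \<bullet> frame e1 e2 e3 w = m * gval (gdot v w)"
proof -
  obtain x y z x' y' z' where vw: "v = (x, y, z)" "w = (x', y', z')"
    by (cases v rule: prod_cases3; cases w rule: prod_cases3)
  have "e2 \<bullet> e1 = 0" "e3 \<bullet> e1 = 0" "e3 \<bullet> e2 = 0"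
    using assms by (simp_all add: orthogonal_frame_def inner_commute)
  then show ?thesis
    using assms unfolding vw orthogonal_frame_def
    by (simp add: inner_add_left inner_add_right gval_gadd gval_gmul distrib_left)
qed

text \<open>Three nonzero orthogonal vectors span the space, so \<open>w\<close> is orthogonal to
  itself.\<close>

lemma orthogonal_frame_zero:
  assumes f: "orthogonal_frame m e1 e2 e3" and w: "w \<bullet> e1 = 0" "w \<bullet> e2 = 0" "w \<bullet> e3 = 0"
  shows "w = 0"
proof -
  have ne: "e1 \<noteq> 0" "e2 \<noteq> 0" "e3 \<noteq> 0" "e1 \<noteq> e2" "e1 \<noteq> e3" "e2 \<noteq> e3"
    using f unfolding orthogonal_frame_def by auto
  have "pairwise orthogonal {e1, e2, e3}"
    using f unfolding orthogonal_frame_def pairwise_def orthogonal_def by (auto simp: inner_commute)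
  then have "independent {e1, e2, e3}"
    using ne by (intro pairwise_orthogonal_independent) auto
  moreover have "card {e1, e2, e3} = 3" using ne by simp
  ultimately have "UNIV \<subseteq> span {e1, e2, e3}"
    by (intro card_ge_dim_independent) simp_all
  then have "w \<in> span {e1, e2, e3}" by blast
  then have "orthogonal w w"
    using w by (intro orthogonal_to_span[of w "{e1, e2, e3}"]) (auto simp: orthogonal_def)
  then show ?thesis by (simp add: orthogonal_def)
qed

lemma frame_inj:
  assumes "orthogonal_frame m e1 e2 e3"
  shows "inj (frame e1 e2 e3)"
proof (rule injI)
  fix v w assume eq: "frame e1 e2 e3 v = frame e1 e2 e3 w"
  obtain x y z x' y' z' where vw: "v = (x, y, z)" "w = (x', y', z')"
    by (cases v rule: prod_cases3; cases w rule: prod_cases3)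
  have m: "m \<noteq> 0" using assms unfolding orthogonal_frame_def by simp
  have coord: "gval (gdot v u) = gval (gdot w u)" for u
    using frame_gdot[OF assms, of v u] frame_gdot[OF assms, of w u] eq m by simp
  have one: "gval (1, 0) = 1" "gval (0, 0) = 0" by (simp_all add: gval_def)
  have "gval x = gval x'" "gval y = gval y'" "gval z = gval z'"
    using coord[of "((1,0), (0,0), (0,0))"] coord[of "((0,0), (1,0), (0,0))"]
      coord[of "((0,0), (0,0), (1,0))"] unfolding vw by (simp_all add: gval_gadd gval_gmul one)
  then show "v = w" unfolding vw by (simp add: gval_inject)
qed

definition realizes :: "(real^3) set \<Rightarrow> (gvec \<Rightarrow> real^3) \<Rightarrow> flag \<Rightarrow> bool" where
  "realizes P h q \<longleftrightarrow> (case q of (v, a, b, c) \<Rightarrow> \<exists>T D1 D2. corner P (h v) (h a) (h b) (h c) T D1 D2)"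

lemma (in trunc_dodec) realizes_walk:
  assumes "realizes P (\<lambda>v. p + frame e1 e2 e3 v) q" "q' \<in> set (flag_walk q ss)"
  shows "realizes P (\<lambda>v. p + frame e1 e2 e3 v) q'"
  using assms
proof (induction ss arbitrary: q)
  case Nil
  then show ?case by simp
next
  case (Cons s ss)
  define h where "h v = p + frame e1 e2 e3 v" for v
  have g: "gval (0, 1) = golden" by (simp add: gval_def)
  \<comment> \<open>The extrapolation is an affine combination, its coefficients having sum 1, so it
    commutes with the affine map \<open>h\<close>.\<close>
  have aff: "h (vdiff (vadd a (vscale (0, 1) (vdiff a v))) (vdiff v c)) =
      h a + golden *\<^sub>R (h a - h v) - (h v - h c)" for a v c
    unfolding h_def by (simp add: frame_vadd frame_vscale frame_vdiff g)
  have step: "realizes P h (flag_swap r) \<and> realizes P h (flag_triangle r) \<and> realizes P h (flag_decagon r)"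
    if hr: "realizes P h r" for r
  proof -
    obtain v a b c where r: "r = (v, a, b, c)" by (rule prod_cases4)
    obtain T D1 D2 where c: "corner P (h v) (h a) (h b) (h c) T D1 D2"
      using hr unfolding realizes_def r by auto
    show ?thesis
      using corner_swap[OF c] corner_step_triangle[OF c] corner_step_decagon[OF c]
      unfolding realizes_def r flag_swap.simps flag_triangle.simps flag_decagon.simps prod.case aff by blast
  qed
  define r where "r = (if s = 0 then flag_triangle q
      else if s = 1 then flag_triangle (flag_swap q) else flag_decagon q)"
  have q: "realizes P h q" using Cons.prems(1) unfolding h_def .
  then have "realizes P h r" using step unfolding r_def by simp
  moreover have "q' = q \<or> q' \<in> set (flag_walk r ss)" using Cons.prems(2) unfolding r_def by simp
  ultimately show ?case using Cons.IH[of r] q unfolding h_def by blast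
qed

lemma (in trunc_dodec) base_realized:
  obtains p m e1 e2 e3 where "orthogonal_frame m e1 e2 e3"
    "realizes P (\<lambda>v. p + frame e1 e2 e3 v) base_flag"
proof -
  obtain x where x: "x \<in> vertex_set P" using vertex_exists .
  obtain y1 y2 y3 T D1 D2 where c: "corner P x y1 y2 y3 T D1 D2" using corner_exists[OF x] .
  define g1 g2 g3 where "g1 = y1 - x" and "g2 = y2 - x" and "g3 = y3 - x"
  obtain q where q: "q > 0" "g1 \<bullet> g1 = q" "g2 \<bullet> g2 = q" "g3 \<bullet> g3 = q"
    "g1 \<bullet> g2 = q / 2" "g1 \<bullet> g3 = - golden * q / 2" "g2 \<bullet> g3 = - golden * q / 2"
    using corner_gram[OF c] unfolding g1_def g2_def g3_def .
  then have q': "g2 \<bullet> g1 = q / 2" "g3 \<bullet> g1 = - golden * q / 2" "g3 \<bullet> g2 = - golden * q / 2"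
    by (simp_all add: inner_commute)
  \<comment> \<open>In the base flag the edge vectors are
    \<open>g1 = (golden - 1) e1 + e2 + (golden - 2) e3\<close>, \<open>g2\<close> the same with
    \<open>e1\<close> negated, and \<open>g3 = (2 - 2 golden) e2\<close>. Solving for the axes, with
    \<open>golden\<close> inverse to \<open>golden - 1\<close> and its square inverse to
    \<open>2 - golden\<close>, gives these vectors.\<close>
  define s1 s2 s3 where "s1 = (1/2) *\<^sub>R (g1 - g2)" and "s2 = (- 1/2) *\<^sub>R g3"
    and "s3 = golden *\<^sub>R s2 - (1/2) *\<^sub>R (g1 + g2)"
  define e1 e2 e3 where "e1 = golden *\<^sub>R s1" and "e2 = golden *\<^sub>R s2"
    and "e3 = (golden * golden) *\<^sub>R s3"
  define m where "m = golden * golden * (q / 4)"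
  have g_cubed: "(golden - 1) * golden = 1" "(golden - 2) * (golden * golden) = - 1"
    using golden_sq by (simp_all add: algebra_simps)
  have s: "s1 \<bullet> s1 = q / 4" "s2 \<bullet> s2 = q / 4" "s1 \<bullet> s2 = 0"
    unfolding s1_def s2_def
    by (simp_all add: inner_diff_left inner_diff_right q q')
  have s1g: "s1 \<bullet> (g1 + g2) = 0" and s2g: "s2 \<bullet> (g1 + g2) = golden * q / 2"
    and gg: "(g1 + g2) \<bullet> (g1 + g2) = 3 * q"
    unfolding s1_def s2_def by (simp_all add: inner_diff_left inner_add_left inner_add_right q q')
  have s13: "s1 \<bullet> s3 = 0"
    unfolding s3_def inner_diff_right inner_scaleR_right by (simp only: s s1g)
  have s23: "s2 \<bullet> s3 = 0"
    unfolding s3_def inner_diff_right inner_scaleR_right by (simp add: s s2g)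
  have "s3 \<bullet> s3 = - ((1/2) * ((g1 + g2) \<bullet> s3)) + golden * (s2 \<bullet> s3)"
    by (subst (1) s3_def) (simp add: inner_diff_left)
  also have "(g1 + g2) \<bullet> s3 = golden * (golden * q / 2) - 3 * q / 2"
    unfolding s3_def inner_diff_right inner_scaleR_right
    by (simp only: gg inner_commute[of "g1 + g2" s2] s2g)
  finally have s33: "s3 \<bullet> s3 = (3 - golden * golden) * (q / 4)" using s23 by (simp add: field_simps)
  \<comment> \<open>This identity makes the third axis as long as the other two:
    \<open>3 - golden * golden\<close> is the inverse of \<open>golden * golden\<close>.\<close>
  have "golden * golden * (golden * golden) * (3 - golden * golden) = golden * golden"
    using golden_sq by algebra
  then have "golden * golden * (golden * golden) * (3 - golden * golden) * (q / 4) = m"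
    unfolding m_def by simp
  then have e33: "e3 \<bullet> e3 = m" unfolding e3_def by (simp add: s33 mult.assoc)
  have frame: "orthogonal_frame m e1 e2 e3"
    unfolding orthogonal_frame_def using e33
    by (simp add: e1_def e2_def e3_def m_def s s13 s23 q golden_pos)
  define v0 :: gvec where "v0 = ((0, 0), (- 1, 1), (2, 1))"
  define h where "h v = (x - frame e1 e2 e3 v0) + frame e1 e2 e3 v" for v
  have E1: "(golden - 1) *\<^sub>R e1 = s1"
    using g_cubed(1) unfolding e1_def by simp
  have E1': "(1 - golden) *\<^sub>R e1 = - s1"
    unfolding E1[symmetric] by (simp add: algebra_simps)
  have E3: "(golden - 2) *\<^sub>R e3 = - s3"
    using g_cubed(2) unfolding e3_def by simp
  have "(2 - 2 * golden) * (golden * (- 1 / 2)) = 1"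
    using g_cubed(1) by (simp add: algebra_simps)
  then have E2: "(2 - 2 * golden) *\<^sub>R e2 = g3"
    unfolding e2_def s2_def scaleR_scaleR by (simp only: scaleR_one)
  have h: "h v = x + frame e1 e2 e3 (vdiff v v0)" for v
    unfolding h_def by (simp add: frame_vdiff)
  have half: "s1 + (1/2) *\<^sub>R (g1 + g2) = g1" "- s1 + (1/2) *\<^sub>R (g1 + g2) = g2"
    unfolding s1_def by (simp_all add: vec_eq_iff field_simps)
  have "h v0 = x" unfolding h_def by simp
  moreover have "h ((- 1, 1), (0, 1), (0, 2)) = y1"
  proof -
    have "h ((- 1, 1), (0, 1), (0, 2)) = x + ((golden - 1) *\<^sub>R e1 + e2 + (golden - 2) *\<^sub>R e3)"
      unfolding h v0_def vdiff_def by (simp add: gval_def algebra_simps)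
    also have "\<dots> = x + (s1 + (1/2) *\<^sub>R (g1 + g2))" unfolding E1 E3 s3_def e2_def by simp
    also have "\<dots> = y1" unfolding half by (simp add: g1_def)
    finally show ?thesis .
  qed
  moreover have "h ((1, - 1), (0, 1), (0, 2)) = y2"
  proof -
    have "h ((1, - 1), (0, 1), (0, 2)) = x + ((1 - golden) *\<^sub>R e1 + e2 + (golden - 2) *\<^sub>R e3)"
      unfolding h v0_def vdiff_def by (simp add: gval_def algebra_simps)
    also have "\<dots> = x + (- s1 + (1/2) *\<^sub>R (g1 + g2))" unfolding E1' E3 s3_def e2_def by simp
    also have "\<dots> = y2" unfolding half by (simp add: g2_def)
    finally show ?thesis .
  qed
  moreover have "h ((0, 0), (1, - 1), (2, 1)) = y3"
  proof -
    have "h ((0, 0), (1, - 1), (2, 1)) = x + (2 - 2 * golden) *\<^sub>R e2"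
      unfolding h v0_def vdiff_def by (simp add: gval_def algebra_simps)
    then show ?thesis unfolding E2 g3_def by simp
  qed
  ultimately have "realizes P h base_flag"
    unfolding realizes_def base_flag_def v0_def using c by auto
  then show ?thesis
    using that[OF frame] unfolding h_def by blast
qed

lemma frame_fold_vadd:
  "frame e1 e2 e3 (fold vadd vs v) = sum_list (map (frame e1 e2 e3) vs) + frame e1 e2 e3 v"
  by (induction vs arbitrary: v) (simp_all add: frame_vadd)

lemma sum_list_translate:
  "sum_list (map (\<lambda>v. p + f v) vs) = real (length vs) *\<^sub>R p + sum_list (map f vs)" for p :: "real^3"
  by (induction vs) (simp_all add: scaleR_add_left)

text \<open>The walk produces sixty distinct vertices, which exhaust the at most sixty vertices of
  \<open>P\<close>. The model has vertex sum zero, so the centroid condition removes the translation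
  \<open>p\<close>.\<close>

lemma (in trunc_dodec) model_realized:
  obtains m e1 e2 e3 where "orthogonal_frame m e1 e2 e3"
    "\<And>q. q \<in> set model_flags \<Longrightarrow> realizes P (frame e1 e2 e3) q"
    "vertex_set P = frame e1 e2 e3 ` set model_vertices"
proof -
  obtain p m e1 e2 e3 where f: "orthogonal_frame m e1 e2 e3"
    and b: "realizes P (\<lambda>v. p + frame e1 e2 e3 v) base_flag" using base_realized .
  define h where "h v = p + frame e1 e2 e3 v" for v
  have real: "realizes P h q" if "q \<in> set model_flags" for q
    using realizes_walk[OF b] that unfolding model_flags_def h_def by blast
  have inj: "inj_on h A" for A
    using frame_inj[OF f] unfolding h_def inj_on_def by auto
  have sub: "h ` set model_vertices \<subseteq> vertex_set P"
  proof -
    have "h (fst q) \<in> vertex_set P" if "realizes P h q" for q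
      using that cornerD(1) unfolding realizes_def by (cases q) auto
    then show ?thesis using real unfolding model_vertices_def set_map image_image by blast
  qed
  have "card (h ` set model_vertices) = 60"
    using model_vertices_distinct by (simp add: card_image[OF inj] distinct_card)
  then have V: "vertex_set P = h ` set model_vertices"
    using card_seteq[OF finite_vertex_set sub] card_vertex_set by simp
  have "0 = (\<Sum>x\<in>vertex_set P. x)" using P unfolding truncated_dodecahedron_def by simp
  also have "\<dots> = sum_list (map h model_vertices)"
    unfolding V using model_vertices_distinct(1) by (simp add: sum.reindex[OF inj] sum.distinct_set_conv_list)
  also have "\<dots> = 60 *\<^sub>R p"
    using frame_fold_vadd[of e1 e2 e3 model_vertices "((0, 0), (0, 0), (0, 0))"] model_vertices_distinct(2)
    unfolding h_def sum_list_translate model_vertices_sum frame_zero by simp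
  finally have "p = 0" by simp
  then have "h = frame e1 e2 e3" unfolding h_def by auto
  then show ?thesis using that[OF f] real V by blast
qed

subsection \<open>The second-order motion\<close>

lemma facet_motion_scale: "(n, d, a1, a2) \<in> set facet_motion \<Longrightarrow> gval d \<noteq> 0"
proof -
  have "list_all (\<lambda>(n, d, a1, a2). d \<noteq> (0, 0)) facet_motion" by code_simp
  moreover assume "(n, d, a1, a2) \<in> set facet_motion"
  ultimately show ?thesis unfolding list_all_iff gval_eq_0 by auto
qed

text \<open>Cramer's rule: the inner products of \<open>z\<close> with the axes solve a homogeneous
  linear system with nonzero determinant.\<close>

lemma normal_unique:
  assumes f: "orthogonal_frame m e1 e2 e3" and det: "gdet u v w \<noteq> (0, 0)"
    and z: "z \<bullet> frame e1 e2 e3 u = 0" "z \<bullet> frame e1 e2 e3 v = 0" "z \<bullet> frame e1 e2 e3 w = 0"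
  shows "z = 0"
proof -
  obtain a b c where u: "u = (a, b, c)" by (rule prod_cases3)
  obtain d e f where v: "v = (d, e, f)" by (rule prod_cases3)
  obtain g h i where w: "w = (g, h, i)" by (rule prod_cases3)
  define A B C D E F G H I where "A = gval a" and "B = gval b" and "C = gval c"
    and "D = gval d" and "E = gval e" and "F = gval f" and "G = gval g" and "H = gval h" and "I = gval i"
  note defs = A_def B_def C_def D_def E_def F_def G_def H_def I_def
  define \<delta> where "\<delta> = A * (E * I - F * H) + (B * (F * G - D * I) + C * (D * H - E * G))"
  have "gval (gdet u v w) = \<delta>"
    unfolding \<delta>_def defs u v w by (simp add: gval_gadd gval_gmul gval_gneg)
  then have "\<delta> \<noteq> 0" using det gval_eq_0 by metis
  define r s t where "r = z \<bullet> e1" and "s = z \<bullet> e2" and "t = z \<bullet> e3"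
  have eqs: "A * r + B * s + C * t = 0" "D * r + E * s + F * t = 0" "G * r + H * s + I * t = 0"
    using z unfolding u v w r_def s_def t_def defs by (simp_all add: inner_add_right)
  have "\<delta> * r = 0" "\<delta> * s = 0" "\<delta> * t = 0"
    unfolding \<delta>_def using eqs by algebra+
  then have "r = 0" "s = 0" "t = 0" using \<open>\<delta> \<noteq> 0\<close> by simp_all
  then show ?thesis unfolding r_def s_def t_def by (rule orthogonal_frame_zero[OF f])
qed

theorem mainTheorem10:
  fixes P :: "(real^3) set" and a :: "(real^3) set \<Rightarrow> real^3"
  assumes "truncated_dodecahedron P" and "facet_normals P a"
  shows "\<not> second_order_rigid P a"
proof -
  interpret trunc_dodec P by (rule trunc_dodec.intro) fact
  obtain m e1 e2 e3 where f: "orthogonal_frame m e1 e2 e3"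
    and real: "\<And>q. q \<in> set model_flags \<Longrightarrow> realizes P (frame e1 e2 e3) q"
    and V: "vertex_set P = frame e1 e2 e3 ` set model_vertices"
    using model_realized by metis
  define L where "L = frame e1 e2 e3"
  have m: "m > 0" using f unfolding orthogonal_frame_def by simp
  note dot = frame_gdot[OF f, folded L_def]
  \<comment> \<open>Inner products in the frame carry the factor \<open>m\<close>, so the real
    normal of the plane \<open>(n, d)\<close> is \<open>L n\<close> divided by
    \<open>m * gval d\<close>.\<close>
  define plane_of where "plane_of \<sigma> = (\<lambda>(n, d, a1, a2).
      (n, d, a1, a2) \<in> set facet_motion \<and> a \<sigma> = (1 / (m * gval d)) *\<^sub>R L n)" for \<sigma>
  have plane: "\<exists>N. plane_of \<sigma> N"
    if \<sigma>: "\<sigma> \<in> facet_set P" and mem: "L u \<in> \<sigma>" "L v \<in> \<sigma>" "L w \<in> \<sigma>"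
      and vert: "L u \<in> vertex_set P" "L v \<in> vertex_set P" "L w \<in> vertex_set P"
      and ok: "plane_ok u v w" for \<sigma> u v w
  proof -
    obtain n d a1 a2 where n: "(n, d, a1, a2) \<in> set facet_motion"
      "gdot u n = d" "gdot v n = d" "gdot w n = d"
      using ok by (auto simp: list_ex_iff)
    have d: "gval d \<noteq> 0" using facet_motion_scale n(1) .
    define b where "b = (1 / (m * gval d)) *\<^sub>R L n"
    have b: "(a \<sigma> - b) \<bullet> L y = 0" if "L y \<in> \<sigma>" "L y \<in> vertex_set P" "gdot y n = d" for y
    proof -
      have "L y \<bullet> a \<sigma> = 1" using assms(2) \<sigma> that unfolding facet_normals_def by blast
      moreover have "L y \<bullet> b = 1" using d m that(3) unfolding b_def by (simp add: dot)
      ultimately have "L y \<bullet> (a \<sigma> - b) = 0" by (simp add: inner_diff_right)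
      then show ?thesis by (simp only: inner_commute[of "a \<sigma> - b"])
    qed
    have "a \<sigma> - b = 0"
      using normal_unique[OF f, of u v w "a \<sigma> - b"] ok b mem vert n unfolding L_def by simp
    then have "plane_of \<sigma> (n, d, a1, a2)" using n(1) unfolding b_def plane_of_def by simp
    then show ?thesis by blast
  qed
  have flag_of: "\<exists>v a b c T D1 D2. x = L v \<and> v \<in> set model_vertices \<and> (v, a, b, c) \<in> set model_flags \<and>
      corner P (L v) (L a) (L b) (L c) T D1 D2"
    if x: "x \<in> vertex_set P" for x
  proof -
    obtain v where v: "v \<in> set model_vertices" "x = L v" using x unfolding V L_def by blast
    then obtain a b c where q: "(v, a, b, c) \<in> set model_flags" unfolding model_vertices_def by auto
    have "\<exists>T D1 D2. corner P (L v) (L a) (L b) (L c) T D1 D2"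
      using real[OF q] unfolding realizes_def L_def by simp
    then show ?thesis using v q by blast
  qed
  have "\<exists>N. plane_of \<sigma> N" if \<sigma>: "\<sigma> \<in> facet_set P" for \<sigma>
  proof -
    obtain x where x: "x \<in> vertex_set P" "x \<in> \<sigma>" using facet_has_vertex[OF \<sigma>] .
    then obtain v w1 w2 w3 T D1 D2 where x': "x = L v" "(v, w1, w2, w3) \<in> set model_flags"
      and c: "corner P (L v) (L w1) (L w2) (L w3) T D1 D2" using flag_of by blast
    have ok: "plane_ok v w1 w2" "plane_ok v w1 w3" "plane_ok v w2 w3"
      using model_planes_ok x'(2) unfolding list_all_iff by fastforce+
    have vert: "L v \<in> vertex_set P" "L w1 \<in> vertex_set P" "L w2 \<in> vertex_set P" "L w3 \<in> vertex_set P"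
      using cornerD(8-10)[OF c] unfolding adjacent_def by simp_all
    note fac = corner_facets[OF c]
    have "\<sigma> = T \<or> \<sigma> = D1 \<or> \<sigma> = D2" using cornerD(14)[OF c \<sigma>] x x'(1) by simp
    then show ?thesis
    proof (elim disjE)
      assume "\<sigma> = T"
      then show ?thesis using plane[OF \<sigma> _ _ _ _ _ _ ok(1)] vert fac by simp
    next
      assume "\<sigma> = D1"
      then show ?thesis using plane[OF \<sigma> _ _ _ _ _ _ ok(2)] vert fac by simp
    next
      assume "\<sigma> = D2"
      then show ?thesis using plane[OF \<sigma> _ _ _ _ _ _ ok(3)] vert fac by simp
    qed
  qed
  \<comment> \<open>A facet may match several table entries; the incidence check covers every entry,
    so any choice works.\<close>
  then obtain N where N: "\<And>\<sigma>. \<sigma> \<in> facet_set P \<Longrightarrow> plane_of \<sigma> (N \<sigma>)" by metis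
  define p' where "p' x = L (fst (vertex_motion_of (inv L x)))" for x
  define p'' where "p'' x = L (snd (vertex_motion_of (inv L x)))" for x
  define a' where "a' \<sigma> = (case N \<sigma> of (n, d, a1, a2) \<Rightarrow> (1 / (m * gval d)) *\<^sub>R L a1)" for \<sigma>
  define a'' where "a'' \<sigma> = (case N \<sigma> of (n, d, a1, a2) \<Rightarrow> (1 / (m * gval d)) *\<^sub>R L a2)" for \<sigma>
  have inv: "inv L (L v) = v" for v using frame_inj[OF f] unfolding L_def by simp
  have diff: "L v - L w = L (vdiff v w)" for v w unfolding L_def by (simp add: frame_vdiff)
  have g0: "gval (0, 0) = 0" "gval (2, 0) = 2" by (simp_all add: gval_def)
  have edge: "(x - y) \<bullet> (p' x - p' y) = 0 \<and>
      (x - y) \<bullet> (p'' x - p'' y) + (p' x - p' y) \<bullet> (p' x - p' y) = 0" if adj: "adjacent P x y" for x y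
  proof -
    have "x \<in> vertex_set P" using adj unfolding adjacent_def by simp
    then obtain v w1 w2 w3 T D1 D2 where x: "x = L v" "(v, w1, w2, w3) \<in> set model_flags"
      and c: "corner P (L v) (L w1) (L w2) (L w3) T D1 D2" using flag_of by blast
    have "flag_edges_ok (v, w1, w2, w3)" using model_edges_ok x(2) unfolding list_all_iff by blast
    moreover have "y \<in> {L w1, L w2, L w3}" using adjacent_corner[OF c] adj x(1) by simp
    ultimately obtain w where w: "y = L w" "edge_ok (v, vertex_motion_of v) (w, vertex_motion_of w)"
      unfolding flag_edges_ok.simps by blast
    obtain r1 r2 where r: "vertex_motion_of v = (r1, r2)" by (cases "vertex_motion_of v")
    obtain s1 s2 where s: "vertex_motion_of w = (s1, s2)" by (cases "vertex_motion_of w")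
    have ok: "gval (gdot (vdiff v w) (vdiff r1 s1)) = 0"
      "gval (gdot (vdiff v w) (vdiff r2 s2)) + gval (gdot (vdiff r1 s1) (vdiff r1 s1)) = 0"
      using w(2) unfolding r s by (simp_all add: g0 flip: gval_gadd)
    have "m * gval (gdot (vdiff v w) (vdiff r2 s2)) + m * gval (gdot (vdiff r1 s1) (vdiff r1 s1)) = 0"
      using ok(2) by (simp flip: distrib_left)
    then show ?thesis
      using ok(1) unfolding p'_def p''_def x(1) w(1) inv r s by (simp add: diff dot)
  qed
  have incidence: "x \<bullet> a' \<sigma> + p' x \<bullet> a \<sigma> = 0 \<and> x \<bullet> a'' \<sigma> + 2 * (p' x \<bullet> a' \<sigma>) + p'' x \<bullet> a \<sigma> = 0"
    if x: "x \<in> vertex_set P" and \<sigma>: "\<sigma> \<in> facet_set P" and mem: "x \<in> \<sigma>" for x \<sigma>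
  proof -
    obtain v where v: "x = L v" "v \<in> set model_vertices" using flag_of[OF x] by blast
    obtain n d a1 a2 where Ns: "N \<sigma> = (n, d, a1, a2)" by (cases "N \<sigma>")
    have n: "(n, d, a1, a2) \<in> set facet_motion" "a \<sigma> = (1 / (m * gval d)) *\<^sub>R L n"
      using N[OF \<sigma>] unfolding Ns plane_of_def by simp_all
    have d: "gval d \<noteq> 0" using facet_motion_scale n(1) .
    obtain r1 r2 where r: "vertex_motion_of v = (r1, r2)" by (cases "vertex_motion_of v")
    have "x \<bullet> a \<sigma> = 1" using assms(2) x \<sigma> mem unfolding facet_normals_def by blast
    then have "gval (gdot v n) = gval d" using m d unfolding n(2) v(1) by (simp add: dot)
    \<comment> \<open>Injectivity of \<open>gval\<close> turns real incidence into the condition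
      guarding \<open>incidence_ok\<close>.\<close>
    then have "gdot v n = d" by (simp add: gval_inject)
    moreover have "incidence_ok (v, vertex_motion_of v) (n, d, a1, a2)"
      using model_incidences_ok v(2) n(1) unfolding list_all_iff by blast
    ultimately have ok: "gval (gdot v a1) + gval (gdot r1 n) = 0"
      "gval (gdot v a2) + (2 * gval (gdot r1 a1) + gval (gdot r2 n)) = 0"
      unfolding r by (simp_all add: g0 flip: gval_gadd gval_gmul g0(2))
    have val: "L y \<bullet> ((1 / (m * gval d)) *\<^sub>R L z) = gval (gdot y z) / gval d" for y z
      using m by (simp add: dot)
    have pa: "p' x = L r1" "p'' x = L r2" "a' \<sigma> = (1 / (m * gval d)) *\<^sub>R L a1"
      "a'' \<sigma> = (1 / (m * gval d)) *\<^sub>R L a2"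
      unfolding p'_def p''_def a'_def a''_def v(1) inv r Ns by simp_all
    have "x \<bullet> a' \<sigma> + p' x \<bullet> a \<sigma> = (gval (gdot v a1) + gval (gdot r1 n)) / gval d"
      unfolding pa n(2) unfolding v(1) val by (simp add: add_divide_distrib)
    moreover have "x \<bullet> a'' \<sigma> + 2 * (p' x \<bullet> a' \<sigma>) + p'' x \<bullet> a \<sigma> =
        (gval (gdot v a2) + (2 * gval (gdot r1 a1) + gval (gdot r2 n))) / gval d"
      unfolding pa n(2) unfolding v(1) val by (simp add: add_divide_distrib)
    ultimately show ?thesis unfolding ok by simp
  qed
  have "second_order_motion P a p' a' p'' a''"
    using edge incidence unfolding second_order_motion_def first_order_motion_def by blast
  moreover have "\<not> trivial_first_order_motion P p'"
  proof -
    \<comment> \<open>Two vertices related by a cyclic shift of coordinates, whose distance changes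
      to first order.\<close>
    define v w :: gvec where "v = ((0, 0), (- 1, 1), (2, 1))" and "w = ((- 1, 1), (2, 1), (0, 0))"
    have vw: "L v \<in> vertex_set P" "L w \<in> vertex_set P"
    proof -
      have "List.member model_vertices ((0, 0), (- 1, 1), (2, 1))"
        "List.member model_vertices ((- 1, 1), (2, 1), (0, 0))" by code_simp+
      then have "v \<in> set model_vertices" "w \<in> set model_vertices" unfolding v_def w_def by simp_all
      then show "L v \<in> vertex_set P" "L w \<in> vertex_set P"
        unfolding V L_def by blast+
    qed
    have "gdot (vdiff ((0, 0), (- 1, 1), (2, 1)) ((- 1, 1), (2, 1), (0, 0)))
        (vdiff (fst (vertex_motion_of ((0, 0), (- 1, 1), (2, 1))))
               (fst (vertex_motion_of ((- 1, 1), (2, 1), (0, 0))))) \<noteq> (0, 0)"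
      by code_simp
    then have "gval (gdot (vdiff v w) (vdiff (fst (vertex_motion_of v)) (fst (vertex_motion_of w)))) \<noteq> 0"
      unfolding v_def w_def gval_eq_0 .
    then have "(L v - L w) \<bullet> (p' (L v) - p' (L w)) \<noteq> 0"
      using m unfolding p'_def inv diff dot by simp
    then show ?thesis using vw unfolding trivial_first_order_motion_def by blast
  qed
  ultimately show ?thesis unfolding second_order_rigid_def by blast
qed

end
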